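(* Let the Pick matrix $P$ of an interpolation data set be invertible, let $\varphi\in\widetilde{\mathbf{N}}_0$, $w=\mathbf{T}_\Theta[\varphi]$, and $i\in\{1,\dots,n\}$. Then $w$ meets the $i$-th interpolation conditions $$w(x_i)=w_i\ \text{ and }\ -\infty<w'(x_i)\le\gamma_i\quad\text{if } i\in\{1,\dots,\ell\},$$ $$-\infty<-w_{-1}^{-1}(x_i)\le-\xi_i^{-1}\quad\text{if } i\in\{\ell+1,\dots,n\},$$ if and only if the parameter $\varphi$ meets one of the conditions $\mathbf C_1,\mathbf C_2,\mathbf C_3$ (in case $\tilde e_i\neq0$) or one of the conditions $\widetilde{\mathbf C}_1,\widetilde{\mathbf C}_2,\widetilde{\mathbf C}_3$ (in case $\tilde e_i=0$) at the node $x_i$.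
   Context: Classes. $\mathbb{C}^+$ is the open upper half plane. For $f$ meromorphic on $\mathbb{C}^+$, $K_f(z,\zeta)=\frac{f(z)-\overline{f(\zeta)}}{z-\bar\zeta}$. $\mathbf{N}_0$ is the Nevanlinna class (functions analytic on $\mathbb{C}^+$ with nonnegative imaginary part) and $\widetilde{\mathbf{N}}_0=\mathbf{N}_0\cup\{\infty\}$, where $\infty$ is the function identically $\infty$. Boundary limits. For $x\in\mathbb{R}$, $f(x)$, $f'(x)$, $f_{-1}(x)$ and $K_f(x,x)$ denote the nontangential limits as $z\to x$ of $f(z)$, $f'(z)$, $(z-x)f(z)$ and $K_f(z,z)$, when they exist (values $\infty$ allowed for $f(x)$, $f_{-1}(x)$, $K_f(x,x)$). If $f\equiv\infty$, then $f_{-1}(x)=\infty$. Here $f_{-1}^{-1}(x)=1/f_{-1}(x)$, with $1/\infty=0$ (while $1/0$ is not finite). Data. $x_1,\dots,x_n$ are distinct real numbers (nodes), $0\le\ell\le n$, $w_j,\gamma_j\in\mathbb{R}$ $(1\le j\le\ell)$, $\xi_k\in\mathbb{R}\setminus\{0\}$ $(\ell<k\le n)$. The Pick matrix $P=[p_{ij}]_{i,j=1}^n$ is the real symmetric matrix with: $p_{ij}=\frac{w_j-w_i}{x_j-x_i}$ for $i\ne j$ and $p_{ii}=\gamma_i$, for $i,j\le\ell$; $p_{ij}=p_{ji}=\frac{\xi_j}{x_j-x_i}$ for $i\le\ell<j$; $p_{ii}=-\xi_i$ and $p_{ij}=0$ $(i\neq j)$ for $i,j>\ell$. Also $X=\mathrm{diag}(x_1,\dots,x_n)$,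 $C=[w_1\ \cdots\ w_\ell\ \xi_{\ell+1}\ \cdots\ \xi_n]$, $E=[1\ \cdots\ 1\ 0\ \cdots\ 0]$ ($\ell$ ones), $J=\begin{bmatrix}0&-i\\ i&0\end{bmatrix}$. For $P$ invertible, $\Theta(z)=[\Theta_{ij}(z)]_{i,j=1}^2=I_2-i\begin{bmatrix}C\\ E\end{bmatrix}(zI-X)^{-1}P^{-1}\begin{bmatrix}C^*&E^*\end{bmatrix}J$ and $\mathbf{T}_\Theta[\varphi]=\frac{\Theta_{11}\varphi+\Theta_{12}}{\Theta_{21}\varphi+\Theta_{22}}$, with $\mathbf{T}_\Theta[\infty]=\Theta_{11}/\Theta_{21}$ ($\mathbf{T}_\Theta[\varphi]\equiv\infty$ if the denominator vanishes identically). Let $\tilde c_i$, $\tilde e_i$ be the $i$-th entries of the row vectors $CP^{-1}$, $EP^{-1}$ (real, not both zero), $\eta_i=\tilde c_i/\tilde e_i$, and $\tilde p_{ii}$ the $i$-th diagonal entry of $P^{-1}$. Conditions on $\varphi\in\widetilde{\mathbf{N}}_0$ at $x_i$ when $\tilde e_i\ne0$: $\mathbf C_1$: the limit $\varphi(x_i)$ does not exist, or exists and is not equal to $\eta_i$. $\mathbf C_2$: $\varphi(x_i)=\eta_i$ and $K_\varphi(x_i,x_i)=\infty$. $\mathbf C_3$: $\varphi(x_i)=\eta_i$ and $-\tilde p_{ii}/\tilde e_i^2<\varphi'(x_i)<\infty$. Conditions at $x_i$ when $\tilde e_i=0$: $\widetilde{\mathbf C}_1$: it is not the case that the limit $\varphi(x_i)$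 exists and equals $\infty$. $\widetilde{\mathbf C}_2$: $\varphi(x_i)=\infty$ and $\varphi_{-1}(x_i)=0$. $\widetilde{\mathbf C}_3$: $\varphi(x_i)=\infty$ and $-\tilde p_{ii}/\tilde c_i^2<-1/\varphi_{-1}(x_i)<\infty$. *)

theory Defs
  imports
    "HOL-Analysis.Analysis"
    "Jordan_Normal_Form.Gauss_Jordan_Elimination"
begin

section \<open>Nevanlinna functions and boundary limits\<close>

definition upper_half_plane :: "complex set" where
  "upper_half_plane = {z. 0 < Im z}"

text \<open>Both for points of the Riemann sphere and for functions, \<open>None\<close> stands for \<open>\<infinity>\<close>:
  the value \<open>\<infinity>\<close>, respectively the function that is identically \<open>\<infinity>\<close>.
  Functions are only ever inspected on the upper half plane.\<close>

type_synonym sphere = "complex option"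
type_synonym ext_fun = "(complex \<Rightarrow> complex) option"

definition nevanlinna :: "(complex \<Rightarrow> complex) set" where
  "nevanlinna = {f. f holomorphic_on upper_half_plane \<and> (\<forall>z\<in>upper_half_plane. 0 \<le> Im (f z))}"

definition ext_nevanlinna :: "ext_fun set" where
  "ext_nevanlinna = insert None (Some ` nevanlinna)"

definition nev_kernel :: "(complex \<Rightarrow> complex) \<Rightarrow> complex \<Rightarrow> complex \<Rightarrow> complex" where
  "nev_kernel f z \<zeta> = (f z - cnj (f \<zeta>)) / (z - cnj \<zeta>)"

definition stolz :: "real \<Rightarrow> real \<Rightarrow> complex set" where
  "stolz x M = {z. 0 < Im z \<and> \<bar>Re z - x\<bar> \<le> M * Im z}"

definition sphere_nhds :: "sphere \<Rightarrow> complex filter" where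
  "sphere_nhds v = (case v of None \<Rightarrow> at_infinity | Some a \<Rightarrow> nhds a)"

definition has_nt_limit :: "(complex \<Rightarrow> complex) \<Rightarrow> real \<Rightarrow> sphere \<Rightarrow> bool" where
  "has_nt_limit g x v \<longleftrightarrow>
     (\<forall>M>0. filterlim g (sphere_nhds v) (at (complex_of_real x) within stolz x M))"

text \<open>The limit \<open>f(x)\<close> exists and equals \<open>v\<close>; likewise below for \<open>f'(x)\<close>, \<open>f\<^sub>-\<^sub>1(x)\<close> and
  \<open>K\<^sub>f(x,x)\<close>.\<close>

definition has_bvalue :: "ext_fun \<Rightarrow> real \<Rightarrow> sphere \<Rightarrow> bool" where
  "has_bvalue f x v = (case f of None \<Rightarrow> v = None | Some g \<Rightarrow> has_nt_limit g x v)"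

definition has_bderiv :: "ext_fun \<Rightarrow> real \<Rightarrow> complex \<Rightarrow> bool" where
  "has_bderiv f x d = (case f of None \<Rightarrow> False | Some g \<Rightarrow> has_nt_limit (deriv g) x (Some d))"

definition has_bresidue :: "ext_fun \<Rightarrow> real \<Rightarrow> sphere \<Rightarrow> bool" where
  "has_bresidue f x v = (case f of None \<Rightarrow> v = None
     | Some g \<Rightarrow> has_nt_limit (\<lambda>z. (z - complex_of_real x) * g z) x v)"

definition has_bkernel :: "ext_fun \<Rightarrow> real \<Rightarrow> sphere \<Rightarrow> bool" where
  "has_bkernel f x v = (case f of None \<Rightarrow> False
     | Some g \<Rightarrow> has_nt_limit (\<lambda>z. nev_kernel g z z) x v)"

definition sphere_inverse :: "sphere \<Rightarrow> sphere" where
  "sphere_inverse v = (case v of None \<Rightarrow> Some 0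
     | Some a \<Rightarrow> (if a = 0 then None else Some (1 / a)))"

text \<open>\<open>f\<^sub>-\<^sub>1(x)\<close> exists and its reciprocal is the finite real number \<open>r\<close>.\<close>

definition has_real_inv_bresidue :: "ext_fun \<Rightarrow> real \<Rightarrow> real \<Rightarrow> bool" where
  "has_real_inv_bresidue f x r \<longleftrightarrow>
     (\<exists>v. has_bresidue f x v \<and> sphere_inverse v = Some (complex_of_real r))"

section \<open>Interpolation data\<close>

text \<open>Indices are shifted to start at 0: the \<open>n\<close> nodes are \<open>x 0, \<dots>, x (n - 1)\<close>, the regular ones
  those with index below \<open>l\<close>. Of the data, \<open>w\<close> and \<open>\<gamma>\<close> are used below \<open>l\<close> only and \<open>\<xi>\<close> from
  \<open>l\<close> on only.\<close>

definition pick_matrix ::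
  "nat \<Rightarrow> nat \<Rightarrow> (nat \<Rightarrow> real) \<Rightarrow> (nat \<Rightarrow> real) \<Rightarrow> (nat \<Rightarrow> real) \<Rightarrow> (nat \<Rightarrow> real) \<Rightarrow> real mat" where
  "pick_matrix n l x w \<gamma> \<xi> = mat n n (\<lambda>(i, j).
     if i < l \<and> j < l then (if i = j then \<gamma> i else (w j - w i) / (x j - x i))
     else if i < l then \<xi> j / (x j - x i)
     else if j < l then \<xi> i / (x i - x j)
     else if i = j then - \<xi> i else 0)"

definition C_row :: "nat \<Rightarrow> nat \<Rightarrow> (nat \<Rightarrow> real) \<Rightarrow> (nat \<Rightarrow> real) \<Rightarrow> real mat" where
  "C_row n l w \<xi> = mat 1 n (\<lambda>(_, j). if j < l then w j else \<xi> j)"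

definition E_row :: "nat \<Rightarrow> nat \<Rightarrow> real mat" where
  "E_row n l = mat 1 n (\<lambda>(_, j). if j < l then 1 else 0)"

definition J_mat :: "complex mat" where
  "J_mat = mat_of_rows_list 2 [[0, - \<i>], [\<i>, 0]]"

definition minv :: "'a :: field mat \<Rightarrow> 'a mat" where
  "minv A = the (mat_inverse A)"

text \<open>The adjoint of \<open>[C; E]\<close> is its transpose, since \<open>C\<close> and \<open>E\<close> are real.\<close>

definition Theta ::
  "nat \<Rightarrow> nat \<Rightarrow> (nat \<Rightarrow> real) \<Rightarrow> (nat \<Rightarrow> real) \<Rightarrow> (nat \<Rightarrow> real) \<Rightarrow> (nat \<Rightarrow> real) \<Rightarrow> complex \<Rightarrow> complex mat"
where
  "Theta n l x w \<gamma> \<xi> z =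
     (let CE = map_mat complex_of_real (C_row n l w \<xi> @\<^sub>r E_row n l);
          X = map_mat complex_of_real (mat_diag n x);
          Pinv = map_mat complex_of_real (minv (pick_matrix n l x w \<gamma> \<xi>))
      in 1\<^sub>m 2 - \<i> \<cdot>\<^sub>m (CE * minv (z \<cdot>\<^sub>m 1\<^sub>m n - X) * Pinv * transpose_mat CE * J_mat))"

text \<open>The linear fractional transformation with a matrix-valued coefficient function. At a zero
  of the denominator, i.e. at a pole of the result, the division yields 0; such points do not
  matter for boundary limits, because for \<open>\<Theta>\<close> as above and an extended Nevanlinna parameter the
  result is \<open>\<infinity>\<close> identically or has only finitely many poles in the upper half plane.\<close>

definition quotient_fun :: "(complex \<Rightarrow> complex) \<Rightarrow> (complex \<Rightarrow> complex) \<Rightarrow> ext_fun" where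
  "quotient_fun num den =
     (if \<forall>z\<in>upper_half_plane. den z = 0 then None else Some (\<lambda>z. num z / den z))"

definition LFT :: "(complex \<Rightarrow> complex mat) \<Rightarrow> ext_fun \<Rightarrow> ext_fun" where
  "LFT T \<phi> = (case \<phi> of
       None \<Rightarrow> quotient_fun (\<lambda>z. T z $$ (0, 0)) (\<lambda>z. T z $$ (1, 0))
     | Some f \<Rightarrow> quotient_fun (\<lambda>z. T z $$ (0, 0) * f z + T z $$ (0, 1))
                             (\<lambda>z. T z $$ (1, 0) * f z + T z $$ (1, 1)))"

definition c_tilde ::
  "nat \<Rightarrow> nat \<Rightarrow> (nat \<Rightarrow> real) \<Rightarrow> (nat \<Rightarrow> real) \<Rightarrow> (nat \<Rightarrow> real) \<Rightarrow> (nat \<Rightarrow> real) \<Rightarrow> nat \<Rightarrow> real" where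
  "c_tilde n l x w \<gamma> \<xi> i = (C_row n l w \<xi> * minv (pick_matrix n l x w \<gamma> \<xi>)) $$ (0, i)"

definition e_tilde ::
  "nat \<Rightarrow> nat \<Rightarrow> (nat \<Rightarrow> real) \<Rightarrow> (nat \<Rightarrow> real) \<Rightarrow> (nat \<Rightarrow> real) \<Rightarrow> (nat \<Rightarrow> real) \<Rightarrow> nat \<Rightarrow> real" where
  "e_tilde n l x w \<gamma> \<xi> i = (E_row n l * minv (pick_matrix n l x w \<gamma> \<xi>)) $$ (0, i)"

definition p_tilde ::
  "nat \<Rightarrow> nat \<Rightarrow> (nat \<Rightarrow> real) \<Rightarrow> (nat \<Rightarrow> real) \<Rightarrow> (nat \<Rightarrow> real) \<Rightarrow> (nat \<Rightarrow> real) \<Rightarrow> nat \<Rightarrow> real" where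
  "p_tilde n l x w \<gamma> \<xi> i = minv (pick_matrix n l x w \<gamma> \<xi>) $$ (i, i)"

section \<open>Interpolation and parameter conditions at a node\<close>

text \<open>\<open>W(x) = w\<close> and \<open>-\<infinity> < W'(x) \<le> \<gamma>\<close>.\<close>

definition regular_condition :: "ext_fun \<Rightarrow> real \<Rightarrow> real \<Rightarrow> real \<Rightarrow> bool" where
  "regular_condition W x w \<gamma> \<longleftrightarrow>
     has_bvalue W x (Some (complex_of_real w)) \<and>
     (\<exists>d::real. has_bderiv W x (complex_of_real d) \<and> d \<le> \<gamma>)"

text \<open>\<open>-\<infinity> < - 1 / W\<^sub>-\<^sub>1(x) \<le> - 1 / \<xi>\<close>.\<close>

definition singular_condition :: "ext_fun \<Rightarrow> real \<Rightarrow> real \<Rightarrow> bool" where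
  "singular_condition W x \<xi> \<longleftrightarrow>
     (\<exists>r::real. has_real_inv_bresidue W x r \<and> - r \<le> - (1 / \<xi>))"

definition cond_C1 :: "ext_fun \<Rightarrow> real \<Rightarrow> real \<Rightarrow> bool" where
  "cond_C1 \<phi> x \<eta> \<longleftrightarrow>
     (\<nexists>v. has_bvalue \<phi> x v) \<or> (\<exists>v. has_bvalue \<phi> x v \<and> v \<noteq> Some (complex_of_real \<eta>))"

definition cond_C2 :: "ext_fun \<Rightarrow> real \<Rightarrow> real \<Rightarrow> bool" where
  "cond_C2 \<phi> x \<eta> \<longleftrightarrow>
     has_bvalue \<phi> x (Some (complex_of_real \<eta>)) \<and> has_bkernel \<phi> x None"

definition cond_C3 :: "ext_fun \<Rightarrow> real \<Rightarrow> real \<Rightarrow> real \<Rightarrow> real \<Rightarrow> bool" where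
  "cond_C3 \<phi> x \<eta> p e \<longleftrightarrow>
     has_bvalue \<phi> x (Some (complex_of_real \<eta>)) \<and>
     (\<exists>d::real. has_bderiv \<phi> x (complex_of_real d) \<and> - p / e\<^sup>2 < d)"

definition cond_C1_tilde :: "ext_fun \<Rightarrow> real \<Rightarrow> bool" where
  "cond_C1_tilde \<phi> x \<longleftrightarrow> \<not> has_bvalue \<phi> x None"

definition cond_C2_tilde :: "ext_fun \<Rightarrow> real \<Rightarrow> bool" where
  "cond_C2_tilde \<phi> x \<longleftrightarrow> has_bvalue \<phi> x None \<and> has_bresidue \<phi> x (Some 0)"

definition cond_C3_tilde :: "ext_fun \<Rightarrow> real \<Rightarrow> real \<Rightarrow> real \<Rightarrow> bool" where
  "cond_C3_tilde \<phi> x p c \<longleftrightarrow>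
     has_bvalue \<phi> x None \<and>
     (\<exists>r::real. has_real_inv_bresidue \<phi> x r \<and> - p / c\<^sup>2 < - r)"

end

theory Submission
  imports Defs "HOL-Complex_Analysis.Complex_Analysis"
begin

text \<open>Write \<open>\<phi> = f / k\<close> in homogeneous coordinates and \<open>W = U / V\<close> accordingly, and let
  \<open>u\<^sub>j = e\<^sub>j f - c\<^sub>j k\<close> with the entries \<open>c\<^sub>j, e\<^sub>j\<close> of \<open>C P\<^sup>-\<^sup>1\<close> and \<open>E P\<^sup>-\<^sup>1\<close>. The Stein equation
  \<open>p\<^sub>i\<^sub>j (x\<^sub>j - x\<^sub>i) = E\<^sub>i C\<^sub>j - C\<^sub>i E\<^sub>j\<close> yields
  \<open>E\<^sub>i U - C\<^sub>i V = (z - x\<^sub>i) (\<Sum>j. p\<^sub>i\<^sub>j u\<^sub>j / (z - x\<^sub>j))\<close>.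
  By the Julia--Caratheodory theorem, \<open>u\<^sub>i\<close> is nontangentially comparable to the other \<open>(z - x\<^sub>i) u\<^sub>j\<close> with
  a ratio \<open>p\<^sub>0 : q\<^sub>0\<close> that is either infinite or finite and nonnegative. With \<open>K = p\<^sub>0 + q\<^sub>0 (P\<^sup>-\<^sup>1)\<^sub>i\<^sub>i\<close>, the
  Stein equation for \<open>P\<^sup>-\<^sup>1\<close> shows that, up to a common factor, \<open>(z - x\<^sub>i) U\<close>, \<open>(z - x\<^sub>i) V\<close> and
  \<open>E\<^sub>i U - C\<^sub>i V\<close> tend to \<open>C\<^sub>i K\<close>, \<open>E\<^sub>i K\<close> and \<open>p\<^sub>i\<^sub>i K - q\<^sub>0\<close>. Hence \<open>W'(x\<^sub>i) = \<gamma>\<^sub>i - q\<^sub>0 / K\<close>,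
  respectively \<open>-1 / W\<^sub>-\<^sub>1(x\<^sub>i) = -1 / \<xi>\<^sub>i - q\<^sub>0 / (\<xi>\<^sub>i\<^sup>2 K)\<close>, and both the interpolation condition and the
  condition on the parameter say that \<open>K > 0\<close>. Poles of \<open>W\<close> do not accumulate at \<open>x\<^sub>i\<close>,
  because a Nevanlinna function that agrees with a real rational function at infinitely many points of the
  half plane equals it, by the Schur algorithm.\<close>

subsection \<open>Nontangential limits\<close>

text \<open>One filter replaces the quantifier over Stolz angles: a property holds eventually iff it
  holds near \<open>x\<close> in each angle, with a radius that may depend on the aperture. Limits
  at boundary points thus become ordinary limits along a filter.\<close>

definition nt :: "real \<Rightarrow> complex filter" where
  "nt x = (SUP M\<in>{0<..}. at (complex_of_real x) within stolz x M)"

lemma has_nt_limit_iff: "has_nt_limit g x v \<longleftrightarrow> filterlim g (sphere_nhds v) (nt x)"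
  by (simp add: has_nt_limit_def nt_def filterlim_def filtermap_SUP SUP_le_iff Ball_def)

lemma eventually_nt:
  "eventually P (nt x) \<longleftrightarrow>
     (\<forall>M>0. \<exists>r>0. \<forall>z. 0 < Im z \<longrightarrow> \<bar>Re z - x\<bar> \<le> M * Im z \<longrightarrow> norm (z - x) < r \<longrightarrow> P z)"
proof -
  have "eventually P (at (complex_of_real x) within stolz x M) \<longleftrightarrow>
      (\<exists>r>0. \<forall>z. 0 < Im z \<longrightarrow> \<bar>Re z - x\<bar> \<le> M * Im z \<longrightarrow> norm (z - x) < r \<longrightarrow> P z)" for M
    unfolding eventually_at dist_norm stolz_def by (intro ex_cong1) auto
  then show ?thesis by (auto simp: nt_def eventually_Sup)
qed

lemma eventually_ntE:
  assumes "eventually P (nt x)" "M > 0"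
  obtains r where "r > 0"
    "\<And>z. 0 < Im z \<Longrightarrow> \<bar>Re z - x\<bar> \<le> M * Im z \<Longrightarrow> norm (z - x) < r \<Longrightarrow> P z"
  using assms unfolding eventually_nt by blast

text \<open>The vertical ray above \<open>x\<close> lies in every Stolz angle. Properness of the
  filter is what makes boundary limits unique.\<close>

lemma nt_neq_bot: "nt x \<noteq> bot"
proof
  assume "nt x = bot"
  then have "eventually (\<lambda>_. False) (nt x)" by simp
  then obtain r where r: "r > 0"
    "\<And>z. 0 < Im z \<Longrightarrow> \<bar>Re z - x\<bar> \<le> 1 * Im z \<Longrightarrow> norm (z - x) < r \<Longrightarrow> False"
    by (rule eventually_ntE[of _ _ 1]) auto
  have e: "Complex x (r/2) - x = \<i> * (r/2)" by (simp add: complex_eq_iff)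
  have "norm (Complex x (r/2) - x) < r"
    unfolding e using r(1) by (simp add: norm_mult)
  then show False using r(2)[of "Complex x (r/2)"] r(1) by simp
qed

lemma nt_le_at: "nt x \<le> at (complex_of_real x)"
  unfolding nt_def by (intro SUP_least at_le) auto

lemma tendsto_nt: "((\<lambda>z. z) \<longlongrightarrow> complex_of_real x) (nt x)"
  by (rule tendsto_mono[OF nt_le_at tendsto_ident_at])

lemma eventually_nt_upper: "eventually (\<lambda>z. z \<in> upper_half_plane) (nt x)"
  unfolding eventually_nt upper_half_plane_def by (auto intro!: exI[of _ 1])

lemma has_nt_limit_unique: "has_nt_limit g x v \<Longrightarrow> has_nt_limit g x v' \<Longrightarrow> v = v'"
  using tendsto_unique[OF nt_neq_bot] not_tendsto_and_filterlim_at_infinity[OF nt_neq_bot]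
  by (auto simp: has_nt_limit_iff sphere_nhds_def split: option.splits)

lemma has_nt_limit_Some: "has_nt_limit g x (Some a) \<longleftrightarrow> (g \<longlongrightarrow> a) (nt x)"
  by (simp add: has_nt_limit_iff sphere_nhds_def)

lemma has_nt_limit_None: "has_nt_limit g x None \<longleftrightarrow> filterlim g at_infinity (nt x)"
  by (simp add: has_nt_limit_iff sphere_nhds_def)

text \<open>Cauchy's estimate on the discs of radius \<open>Im z / 2\<close>, which stay in a wider Stolz angle.\<close>

lemma deriv_tendsto_nt:
  assumes holo: "eventually (\<lambda>z. g field_differentiable at z) (nt x)"
    and lim: "((\<lambda>z. (g z - w) / (z - x)) \<longlongrightarrow> d) (nt x)"
  shows "(deriv g \<longlongrightarrow> d) (nt x)"
  unfolding tendsto_iff eventually_nt dist_norm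
proof (intro allI impI)
  fix e M :: real assume e: "e > 0" and M: "M > 0"
  \<comment> \<open>Cauchy's estimate yields at most \<open>4 * (M + 1) * \<epsilon>\<close> below,
    which this choice makes \<open>e / 2\<close>.\<close>
  define \<epsilon> where "\<epsilon> = e / (8 * (M + 1))"
  have eps: "\<epsilon> > 0" using e M by (simp add: \<epsilon>_def)
  have ev: "eventually (\<lambda>z. g field_differentiable at z \<and> norm ((g z - w) / (z - x) - d) < \<epsilon>) (nt x)"
    using holo lim eps by (auto simp: tendsto_iff dist_norm intro: eventually_conj)
  \<comment> \<open>A point \<open>t\<close> of the disc has \<open>Im t \<ge> Im z / 2\<close> and
    real part within \<open>(2 * M + 1) * (Im z / 2)\<close> of \<open>x\<close>, hence the aperture
    \<open>2 * M + 1\<close>. Its distance to \<open>x\<close> is at most twice that of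
    \<open>z\<close>, hence the radius \<open>r / 2\<close>.\<close>
  then obtain r where r: "r > 0" and
    R: "\<And>z. 0 < Im z \<Longrightarrow> \<bar>Re z - x\<bar> \<le> (2 * M + 1) * Im z \<Longrightarrow> norm (z - x) < r \<Longrightarrow>
        g field_differentiable at z \<and> norm ((g z - w) / (z - x) - d) < \<epsilon>"
    using M by (rule_tac eventually_ntE[OF ev, of "2 * M + 1"]) auto
  show "\<exists>r>0. \<forall>z. 0 < Im z \<longrightarrow> \<bar>Re z - x\<bar> \<le> M * Im z \<longrightarrow> norm (z - x) < r \<longrightarrow> norm (deriv g z - d) < e"
  proof (intro exI[of _ "r/2"] conjI allI impI)
    show "r / 2 > 0" using r by simp
    fix z assume z: "0 < Im z" "\<bar>Re z - x\<bar> \<le> M * Im z" "norm (z - x) < r / 2"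
    define \<rho> where "\<rho> = Im z / 2"
    have zx: "Im z \<le> norm (z - x)" using abs_Im_le_cmod[of "z - x"] z by simp
    have disc: "0 < Im t \<and> \<bar>Re t - x\<bar> \<le> (2 * M + 1) * Im t \<and> norm (t - x) < r \<and> norm (t - x) \<le> 2 * norm (z - x)"
      if "norm (t - z) \<le> \<rho>" for t
    proof -
      have a: "\<bar>Im t - Im z\<bar> \<le> \<rho>" "\<bar>Re t - Re z\<bar> \<le> \<rho>"
        using abs_Im_le_cmod[of "t - z"] abs_Re_le_cmod[of "t - z"] that by simp_all
      have b: "Im t \<ge> Im z / 2" using a(1) unfolding \<rho>_def by (simp add: abs_if split: if_splits)
      have "\<bar>Re t - x\<bar> \<le> M * Im z + Im z / 2" using a(2) z(2) unfolding \<rho>_def by linarith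
      also have "\<dots> = (2 * M + 1) * (Im z / 2)" by (simp add: field_simps)
      also have "\<dots> \<le> (2 * M + 1) * Im t" using b M by (intro mult_left_mono) auto
      finally have c: "\<bar>Re t - x\<bar> \<le> (2 * M + 1) * Im t" .
      have "norm (t - x) \<le> norm (t - z) + norm (z - x)" by (metis norm_triangle_ineq add.commute diff_add_cancel add_diff_eq)
      then have "norm (t - x) \<le> 2 * norm (z - x) \<and> norm (t - x) < r"
        using that zx z unfolding \<rho>_def by linarith
      then show ?thesis using b c z by auto
    qed
    \<comment> \<open>Without the linear part, the assumed limit says that \<open>h\<close> is small
      relative to the distance from \<open>x\<close>, and \<open>deriv h z\<close> is the quantity
      to be estimated.\<close>
    define h where "h = (\<lambda>t. g t - w - d * (t - x))"
    have gd: "g field_differentiable at t" if "norm (t - z) \<le> \<rho>" for t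
      using disc[OF that] R by blast
    have hd: "h field_differentiable at t" if "norm (t - z) \<le> \<rho>" for t
      unfolding h_def using gd[OF that] by (intro derivative_intros) auto
    have hb: "norm (h t) \<le> \<epsilon> * (2 * norm (z - x))" if "norm (t - z) \<le> \<rho>" for t
    proof -
      have tx: "t - x \<noteq> 0" using disc[OF that] by auto
      then have "h t = ((g t - w) / (t - x) - d) * (t - x)"
        by (simp add: h_def field_simps)
      then have "norm (h t) = norm ((g t - w) / (t - x) - d) * norm (t - x)" by (simp add: norm_mult)
      also have "\<dots> \<le> \<epsilon> * (2 * norm (z - x))"
        using disc[OF that] R[of t] eps by (intro mult_mono) auto
      finally show ?thesis .
    qed
    have rho: "\<rho> > 0" using z by (simp add: \<rho>_def)
    have "norm ((deriv ^^ 1) h z) \<le> fact 1 * (\<epsilon> * (2 * norm (z - x))) / \<rho> ^ 1"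
    proof (rule Cauchy_inequality[OF _ _ rho])
      have "h holomorphic_on cball z \<rho>"
        unfolding holomorphic_on_def
        by (auto intro!: field_differentiable_at_within hd simp: dist_norm norm_minus_commute)
      then show "h holomorphic_on ball z \<rho>" "continuous_on (cball z \<rho>) h"
        using holomorphic_on_subset[OF _ ball_subset_cball] holomorphic_on_imp_continuous_on by auto
    qed (auto intro!: hb simp: norm_minus_commute)
    moreover have "deriv h z = deriv g z - d"
    proof -
      have "(g has_field_derivative deriv g z) (at z)"
        using gd[of z] rho field_differentiable_derivI by auto
      then have "(h has_field_derivative (deriv g z - d)) (at z)"
        unfolding h_def by (auto intro!: derivative_eq_intros)
      then show ?thesis by (rule DERIV_imp_deriv)
    qed
    ultimately have le: "norm (deriv g z - d) \<le> \<epsilon> * (2 * norm (z - x)) / \<rho>" by simp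
    have "norm (z - x) \<le> \<bar>Re (z - x)\<bar> + \<bar>Im (z - x)\<bar>" by (rule cmod_le)
    then have "norm (z - x) \<le> (M + 1) * Im z" using z by (simp add: algebra_simps)
    then have "\<epsilon> * (2 * norm (z - x)) / \<rho> \<le> \<epsilon> * (2 * ((M + 1) * Im z)) / \<rho>"
      using rho eps by (intro divide_right_mono mult_left_mono) auto
    also have "\<dots> = e / 2" using z M by (simp add: \<rho>_def \<epsilon>_def field_simps)
    finally show "norm (deriv g z - d) < e" using le e by linarith
  qed
qed

text \<open>A bounded derivative makes \<open>g\<close> Lipschitz on a vertical segment above
  \<open>x\<close>; letting its lower end tend to \<open>x\<close> bounds the difference quotient
  there. The lemma serves to refute an interpolation condition when the quotient blows up.\<close>

lemma bdd_quotient_if_deriv_tendsto: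
  assumes holo: "eventually (\<lambda>z. g field_differentiable at z) (nt x)"
    and lim: "(g \<longlongrightarrow> w) (nt x)" "(deriv g \<longlongrightarrow> d) (nt x)"
  shows "\<not> filterlim (\<lambda>z. (g z - w) / (z - x)) at_infinity (nt x)"
proof
  assume inf: "filterlim (\<lambda>z. (g z - w) / (z - x)) at_infinity (nt x)"
  \<comment> \<open>\<open>B\<close> bounds \<open>deriv g\<close> near \<open>x\<close>, while an
    infinite quotient would be at least \<open>B + 1\<close> there; the two bounds collide at the
    point \<open>p t\<close>.\<close>
  define B where "B = norm d + 1"
  have B: "B > 0" by (simp add: B_def add_nonneg_pos)
  have ev: "eventually (\<lambda>z. g field_differentiable at z \<and> dist (deriv g z) d < 1
       \<and> norm ((g z - w) / (z - x)) \<ge> B + 1) (nt x)"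
    using holo lim(2) inf B unfolding filterlim_at_infinity[OF order_refl] tendsto_iff
    by (intro eventually_conj) auto
  obtain r where r: "r > 0" and
    R: "\<And>z. 0 < Im z \<Longrightarrow> \<bar>Re z - x\<bar> \<le> 1 * Im z \<Longrightarrow> norm (z - x) < r \<Longrightarrow>
        g field_differentiable at z \<and> dist (deriv g z) d < 1 \<and> norm ((g z - w) / (z - x)) \<ge> B + 1"
    by (rule eventually_ntE[OF ev, of 1]) auto
  define p where "p = (\<lambda>s. Complex x s)"
  have pe: "p s - complex_of_real x = \<i> * s" for s by (simp add: p_def complex_eq_iff)
  have seg: "norm (g (p t) - g (p s)) \<le> B * norm (p t - p s)" if "0 < s" "s < r" "0 < t" "t < r" for s t
  proof (rule field_differentiable_bound)
    define S where "S = p ` {0<..<r}"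
    show "convex S"
    proof -
      have "S = (\<lambda>s. complex_of_real x + s) ` (\<lambda>s. \<i> * s) ` complex_of_real ` {0<..<r}"
        unfolding S_def p_def image_image by (intro image_cong) (auto simp: complex_eq_iff)
      moreover have "convex ((\<lambda>s. \<i> * s) ` complex_of_real ` {0<..<r})"
        by (intro convex_linear_image bounded_linear.linear bounded_linear_mult_right bounded_linear_of_real)
          (auto intro: convex_real_interval)
      ultimately show ?thesis by (metis convex_translation)
    qed
    show "(g has_field_derivative deriv g y) (at y within S)" if "y \<in> S" for y
      using that R[of y] unfolding S_def p_def 
      by (auto simp: pe[unfolded p_def] norm_mult intro!: has_field_derivative_at_within field_differentiable_derivI)
    show "norm (deriv g y) \<le> B" if "y \<in> S" for y
    proof -
      have "dist (deriv g y) d < 1"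
        using that R[of y] unfolding S_def p_def by (auto simp: pe[unfolded p_def] norm_mult)
      then show ?thesis unfolding B_def dist_norm using norm_triangle_sub[of "deriv g y" d] by linarith
    qed
    show "p t \<in> S" "p s \<in> S" using that by (auto simp: S_def)
  qed
  have plim: "filterlim p (nt x) (at_right 0)"
    unfolding filterlim_iff
  proof (intro allI impI)
    fix P assume ev: "eventually P (nt x)"
    obtain r where "r > 0" "\<And>z. 0 < Im z \<Longrightarrow> \<bar>Re z - x\<bar> \<le> 1 * Im z \<Longrightarrow> norm (z - x) < r \<Longrightarrow> P z"
      by (rule eventually_ntE[OF ev, of 1]) auto
    then have "P (p s)" if "0 < s" "s < r" for s
      using that pe[of s] by (simp add: p_def norm_mult)
    then show "eventually (\<lambda>s. P (p s)) (at_right 0)"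
      unfolding eventually_at_right_field using \<open>r > 0\<close> by auto
  qed
  define t where "t = r / 2"
  have t: "0 < t" "t < r" using r by (auto simp: t_def)
  have "((\<lambda>s. norm (g (p t) - g (p s))) \<longlongrightarrow> norm (g (p t) - w)) (at_right 0)"
    by (intro tendsto_intros filterlim_compose[OF lim(1) plim])
  moreover have "((\<lambda>s. B * norm (p t - p s)) \<longlongrightarrow> B * norm (p t - complex_of_real x)) (at_right 0)"
    by (intro tendsto_intros filterlim_compose[OF tendsto_nt plim])
  moreover have "eventually (\<lambda>s. norm (g (p t) - g (p s)) \<le> B * norm (p t - p s)) (at_right 0)"
    unfolding eventually_at_right_field using r t seg by auto
  ultimately have "norm (g (p t) - w) \<le> B * norm (p t - complex_of_real x)"
    by (intro tendsto_le[OF trivial_limit_at_right_real]) 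
  moreover have "norm ((g (p t) - w) / (p t - x)) \<ge> B + 1"
    using R[of "p t"] t pe[of t] by (auto simp: p_def norm_mult)
  ultimately show False
    using t unfolding pe norm_divide by (auto simp: norm_mult field_simps)
qed

subsection \<open>Schwarz--Pick and Julia--Caratheodory in the half plane\<close>

lemma open_upper_half_plane: "open upper_half_plane"
  unfolding upper_half_plane_def by (rule open_halfspace_Im_gt)

lemma connected_upper_half_plane: "connected upper_half_plane"
  unfolding upper_half_plane_def by (intro convex_connected convex_halfspace_Im_gt)

lemma ii_in_upper_half_plane: "\<i> \<in> upper_half_plane"
  by (simp add: upper_half_plane_def)

text \<open>The sign of \<open>Im a * Im b\<close> decides whether \<open>a\<close> is closer to
  \<open>b\<close> or to its mirror image. All bounds on Cayley quotients in the half plane come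
  from this identity.\<close>

lemma norm_diff_cnj_sq: "(norm (a - cnj b))\<^sup>2 = (norm (a - b))\<^sup>2 + 4 * Im a * Im b"
  unfolding cmod_power2 by (simp add: power2_eq_square algebra_simps)

section \<open>Maximum principle, Cayley transform and the Schwarz--Pick inequality\<close>

lemma holomorphic_maximum_upper:
  assumes "f holomorphic_on upper_half_plane" "\<And>z. z \<in> upper_half_plane \<Longrightarrow> norm (f z) \<le> norm (f w)"
    "w \<in> upper_half_plane" "z \<in> upper_half_plane"
  shows "f z = f w"
proof -
  have "f constant_on upper_half_plane"
    using maximum_modulus_principle[OF assms(1) open_upper_half_plane connected_upper_half_plane
        open_upper_half_plane order_refl assms(3)] assms(2) by blast
  then show ?thesis using assms unfolding constant_on_def by metis
qed

text \<open>For \<open>c = cnj w\<close> this inverts the Cayley map that sends \<open>w\<close> to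
  0.\<close>

lemma moebius_inverse:
  fixes z w c :: complex
  assumes "z \<noteq> c" "w \<noteq> c"
  shows "(w - c * ((z - w) / (z - c))) / (1 - (z - w) / (z - c)) = z"
proof -
  have "1 - (z - w) / (z - c) = (w - c) / (z - c)" using assms by (simp add: field_simps)
  moreover have "w - c * ((z - w) / (z - c)) = z * (w - c) / (z - c)"
    using assms by (simp add: field_simps)
  ultimately show ?thesis using assms by simp
qed

text \<open>The Cayley map takes the half plane to the unit disc and \<open>w\<close> to 0, where
  Schwarz's lemma applies to \<open>h\<close> composed with the inverse map
  \<open>m\<close>.\<close>

lemma Schwarz_upper_half_plane:
  assumes holo: "h holomorphic_on upper_half_plane"
    and le: "\<And>z. z \<in> upper_half_plane \<Longrightarrow> norm (h z) \<le> 1"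
    and w: "w \<in> upper_half_plane" "h w = 0" and z: "z \<in> upper_half_plane"
  shows "norm (h z) * norm (z - cnj w) \<le> norm (z - w)"
proof -
  define m where "m = (\<lambda>\<zeta>. (w - cnj w * \<zeta>) / (1 - \<zeta>))"
  have Imw: "Im w > 0" and Imz: "Im z > 0" using w z by (auto simp: upper_half_plane_def)
  have m_in: "m \<zeta> \<in> upper_half_plane" if "norm \<zeta> < 1" for \<zeta>
  proof -
    have "Im ((w - cnj w * \<zeta>) * cnj (1 - \<zeta>)) = Im w * (1 - (norm \<zeta>)\<^sup>2)"
      unfolding cmod_power2 by (simp add: power2_eq_square algebra_simps)
    also have "\<dots> > 0"
      using Imw that by (simp add: power_less_one_iff abs_square_less_1)
    finally have "Im (m \<zeta>) > 0" unfolding m_def by (simp only: Im_complex_div_gt_0)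
    then show ?thesis by (simp add: upper_half_plane_def)
  qed
  have zw: "z - cnj w \<noteq> 0"
  proof
    assume "z - cnj w = 0"
    then have "Im (z - cnj w) = 0" by simp
    then show False using Imw Imz by simp
  qed
  have lt: "norm (z - w) < norm (z - cnj w)"
    using norm_diff_cnj_sq[of z w] Imw Imz mult_pos_pos[OF Imz Imw]
    by (intro power2_less_imp_less[OF _ norm_ge_zero]) linarith
  define \<zeta> where "\<zeta> = (z - w) / (z - cnj w)"
  have \<zeta>: "norm \<zeta> < 1" 
    unfolding \<zeta>_def norm_divide using lt zw by (metis divide_less_eq_1_pos zero_less_norm_iff)
  have mz: "m \<zeta> = z"
  proof -
    have "z \<noteq> cnj w" using zw by simp
    moreover have "w \<noteq> cnj w"
    proof
      assume "w = cnj w"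
      then have "Im w = Im (cnj w)" by (rule arg_cong)
      then show False using Imw by simp
    qed
    ultimately show ?thesis unfolding m_def \<zeta>_def by (rule moebius_inverse)
  qed
  have holm: "(\<lambda>\<zeta>. h (m \<zeta>)) holomorphic_on ball 0 1"
    using m_in by (intro holomorphic_on_compose_gen[OF _ holo, unfolded o_def])
      (auto simp: m_def intro!: holomorphic_intros)
  \<comment> \<open>Schwarz's lemma asks for a strict bound, but \<open>h\<close> may have modulus
    1; so \<open>h\<close> is scaled by \<open>r < 1\<close>, and \<open>r\<close> tends to 1
    afterwards.\<close>
  have "r * norm (h z) \<le> norm \<zeta>" if r: "0 \<le> r" "r < 1" for r :: real
  proof -
    have "norm (of_real r * h (m \<zeta>)) \<le> norm \<zeta>"
    proof (rule Schwarz_Lemma(1)[OF _ _ _ \<zeta>])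
      show "(\<lambda>\<zeta>. of_real r * h (m \<zeta>)) holomorphic_on ball 0 1"
        by (intro holomorphic_intros holm)
      show "of_real r * h (m 0) = 0" using w by (simp add: m_def)
      show "norm (of_real r * h (m s)) < 1" if "norm s < 1" for s
      proof -
        have "r * norm (h (m s)) \<le> r * 1" using le[OF m_in[OF that]] r by (intro mult_left_mono) auto
        then show ?thesis using r by (simp add: norm_mult)
      qed
    qed
    then show ?thesis using r by (simp add: mz norm_mult)
  qed
  then have "norm (h z) \<le> norm \<zeta>"
    by (intro field_le_mult_one_interval[of "norm (h z)"]) auto
  then show ?thesis
    unfolding \<zeta>_def norm_divide using zw by (subst (asm) pos_le_divide_eq) auto
qed

lemma nevanlinnaD:
  assumes "f \<in> nevanlinna"
  shows "f holomorphic_on upper_half_plane" "z \<in> upper_half_plane \<Longrightarrow> 0 \<le> Im (f z)"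
  using assms by (auto simp: nevanlinna_def)

lemma norm_cayley_le:
  assumes "0 \<le> Im a" "0 < Im b"
  shows "norm ((a - b) / (a - cnj b)) \<le> 1" "a - cnj b \<noteq> 0"
proof -
  have "norm (a - b) \<le> norm (a - cnj b)"
    using norm_diff_cnj_sq[of a b] assms mult_nonneg_nonneg[of "Im a" "Im b"]
    by (intro power2_le_imp_le[OF _ norm_ge_zero]) linarith
  moreover show nz: "a - cnj b \<noteq> 0" 
  proof
    assume "a - cnj b = 0"
    then have "Im (a - cnj b) = 0" by simp
    then show False using assms by simp
  qed
  ultimately show "norm ((a - b) / (a - cnj b)) \<le> 1"
    unfolding norm_divide by (metis divide_le_eq_1_pos zero_less_norm_iff)
qed

lemma holomorphic_cayley_nevanlinna:
  assumes "f \<in> nevanlinna" "0 < Im b"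
  shows "(\<lambda>z. (f z - b) / (f z - cnj b)) holomorphic_on upper_half_plane"
  using nevanlinnaD[OF assms(1)] norm_cayley_le(2)[OF _ assms(2)] by (auto intro!: holomorphic_intros)

text \<open>At a real value of \<open>f\<close> the Cayley transform of \<open>f\<close> attains
  modulus 1, its largest possible, inside the half plane, so the maximum principle applies.\<close>

lemma nevanlinna_constant:
  assumes f: "f \<in> nevanlinna" and w: "w \<in> upper_half_plane" "Im (f w) = 0" and z: "z \<in> upper_half_plane"
  shows "f z = f w"
proof -
  define g where "g = (\<lambda>z. (f z - \<i>) / (f z - cnj \<i>))"
  have 1: "norm (g w) = 1"
  proof -
    have "norm (f w - \<i>) = norm (f w - cnj \<i>)"
      using norm_diff_cnj_sq[of "f w" \<i>] w(2) by (simp add: power2_eq_iff_nonneg)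
    then show ?thesis using norm_cayley_le(2)[of "f w" \<i>] w(2) by (simp add: g_def norm_divide)
  qed
  have "g z = g w"
  proof (rule holomorphic_maximum_upper[OF _ _ w(1) z])
    show "g holomorphic_on upper_half_plane"
      unfolding g_def by (rule holomorphic_cayley_nevanlinna[OF f]) simp
    show "norm (g t) \<le> norm (g w)" if "t \<in> upper_half_plane" for t
      using norm_cayley_le(1)[OF nevanlinnaD(2)[OF f that], of \<i>] unfolding 1 by (simp add: g_def)
  qed
  then show ?thesis
    using norm_cayley_le(2)[of "f w" \<i>] norm_cayley_le(2)[of "f z" \<i>]
      nevanlinnaD(2)[OF f z] w(2) unfolding g_def by (simp add: field_simps)
qed

text \<open>Positivity of the kernel at two points: the squared modulus of
  \<open>nev_kernel f z w\<close> is at most the product of the diagonal values. It is Schwarz's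
  lemma for the Cayley transform of \<open>f\<close> at \<open>f w\<close>; if \<open>f w\<close> is
  real, both sides vanish. The form without denominators survives letting \<open>w\<close> tend to
  the real line.\<close>

lemma Schwarz_Pick_nevanlinna:
  assumes f: "f \<in> nevanlinna" and z: "z \<in> upper_half_plane" and w: "w \<in> upper_half_plane"
  shows "(norm (f z - cnj (f w)))\<^sup>2 * (Im z * Im w) \<le> (norm (z - cnj w))\<^sup>2 * (Im (f z) * Im (f w))"
proof (cases "Im (f w) = 0")
  case True
  have "f z = f w" by (rule nevanlinna_constant[OF f w True z])
  moreover have "cnj (f w) = f w" using True by (simp add: complex_eq_iff)
  ultimately show ?thesis using True by simp
next
  case False
  then have pos: "Im (f w) > 0" using nevanlinnaD(2)[OF f w] by simp
  have nz: "f z - cnj (f w) \<noteq> 0" using norm_cayley_le(2) nevanlinnaD(2)[OF f z] pos by blast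
  have "norm ((f z - f w) / (f z - cnj (f w))) * norm (z - cnj w) \<le> norm (z - w)"
    by (rule Schwarz_upper_half_plane[OF holomorphic_cayley_nevanlinna[OF f pos] _ w _ z])
      (auto intro!: norm_cayley_le nevanlinnaD(2)[OF f] pos)
  then have "norm (f z - f w) * norm (z - cnj w) \<le> norm (z - w) * norm (f z - cnj (f w))"
    using nz by (simp add: norm_divide field_simps)
  then have "(norm (f z - f w) * norm (z - cnj w))\<^sup>2 \<le> (norm (z - w) * norm (f z - cnj (f w)))\<^sup>2"
    by (intro power_mono) auto
  then show ?thesis
    using norm_diff_cnj_sq[of "f z" "f w"] norm_diff_cnj_sq[of z w]
    unfolding power_mult_distrib by (simp add: algebra_simps)
qed

section \<open>Residues, difference quotients and the kernel at a boundary point\<close>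

lemma Im_inverse_shift: "Im (1 / (z - complex_of_real x)) = - Im z / (norm (z - x))\<^sup>2"
  by (simp add: Im_divide cmod_power2)

text \<open>The residue is minus the infimum of \<open>Im f / Im (-1 / (z - x))\<close>. Once the corresponding
  pole is split off, the infimum is 0, and Schwarz--Pick against a near-minimiser bounds the rest.\<close>

lemma nevanlinna_residue:
  assumes f: "f \<in> nevanlinna"
  obtains m :: real where "0 \<le> m" "((\<lambda>z. (z - x) * f z) \<longlongrightarrow> - complex_of_real m) (nt x)"
proof -
  define \<Phi> where "\<Phi> = (\<lambda>w. Im (f w) * (norm (w - complex_of_real x))\<^sup>2 / Im w)"
  define m where "m = (INF w\<in>upper_half_plane. \<Phi> w)"
  have ne: "upper_half_plane \<noteq> {}" using ii_in_upper_half_plane by auto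
  have \<Phi>0: "0 \<le> \<Phi> w" if "w \<in> upper_half_plane" for w
    using nevanlinnaD(2)[OF f that] that by (auto simp: \<Phi>_def upper_half_plane_def)
  have bdd: "bdd_below (\<Phi> ` upper_half_plane)" using \<Phi>0 by (auto intro!: bdd_belowI)
  have m0: "0 \<le> m" unfolding m_def by (rule cINF_greatest[OF ne \<Phi>0])
  have mle: "m \<le> \<Phi> w" if "w \<in> upper_half_plane" for w
    unfolding m_def by (rule cINF_lower[OF bdd that])
  \<comment> \<open>Removing the pole \<open>- m / (z - x)\<close> lowers \<open>\<Phi>\<close> by
    the constant \<open>m\<close>, so the imaginary part stays nonnegative and the infimum becomes
    0.\<close>
  define G where "G = (\<lambda>z::complex. f z + m * (1 / (z - x)))"
  have zx: "z - complex_of_real x \<noteq> 0" if "z \<in> upper_half_plane" for z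
    using that by (auto simp: upper_half_plane_def complex_eq_iff)
  have ImG: "Im (G w) * (norm (w - complex_of_real x))\<^sup>2 / Im w = \<Phi> w - m" if "w \<in> upper_half_plane" for w
  proof -
    have "Im (G w) = Im (f w) - m * Im w / (norm (w - complex_of_real x))\<^sup>2"
      unfolding G_def plus_complex.sel times_complex.sel Im_inverse_shift by simp
    then show ?thesis
      using zx[OF that] that by (simp add: \<Phi>_def upper_half_plane_def field_simps)
  qed
  have G: "G \<in> nevanlinna"
    unfolding nevanlinna_def
  proof (intro CollectI conjI ballI)
    show "G holomorphic_on upper_half_plane"
      unfolding G_def using zx nevanlinnaD(1)[OF f] by (auto intro!: holomorphic_intros)
    show "0 \<le> Im (G z)" if "z \<in> upper_half_plane" for z
    proof -
      have "0 \<le> Im (G z) * ((norm (z - complex_of_real x))\<^sup>2 / Im z)"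
        using ImG[OF that] mle[OF that] by simp
      moreover have "(norm (z - complex_of_real x))\<^sup>2 / Im z > 0"
        using that zx[OF that] by (simp add: upper_half_plane_def)
      ultimately show ?thesis using zero_le_mult_iff not_less by metis
    qed
  qed
  have "((\<lambda>z. (z - x) * G z) \<longlongrightarrow> 0) (nt x)"
    unfolding tendsto_iff eventually_nt dist_norm
  proof (intro allI impI)
    fix e M :: real assume e: "e > 0" and M: "M > 0"
    have "m + e / (M + 1) > m" using e M by simp
    then obtain w where w: "w \<in> upper_half_plane" and "\<Phi> w < m + e / (M + 1)"
      using cINF_less_iff[OF ne bdd] unfolding m_def by metis
    then have we: "(M + 1) * (\<Phi> w - m) < e" using M by (simp add: field_simps)
    have Imw: "Im w > 0" using w by (simp add: upper_half_plane_def)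
    \<comment> \<open>As \<open>z\<close> tends to \<open>x\<close>, the first summand vanishes and
      the second tends to \<open>(M + 1) * (\<Phi> w - m)\<close>, which is below \<open>e\<close>
      by the choice of \<open>w\<close>. Below, the first summand alone handles the case
      \<open>a \<le> 2 * b\<close>.\<close>
    define R where "R = (\<lambda>z. 2 * norm (z - complex_of_real x) * norm (G w)
        + (M + 1) * ((norm (z - cnj w))\<^sup>2 * (Im (G w) / Im w)))"
    have "(R \<longlongrightarrow> 2 * norm (complex_of_real x - x) * norm (G w)
        + (M + 1) * ((norm (x - cnj w))\<^sup>2 * (Im (G w) / Im w))) (nt x)"
      unfolding R_def by (intro tendsto_intros tendsto_nt)
    moreover have "norm (x - cnj w) = norm (w - x)"
      by (metis complex_cnj_complex_of_real complex_cnj_diff complex_mod_cnj norm_minus_commute)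
    ultimately have "(R \<longlongrightarrow> (M + 1) * (\<Phi> w - m)) (nt x)"
      unfolding ImG[OF w, symmetric] by (simp add: mult.commute)
    then have "eventually (\<lambda>z. R z < e) (nt x)" using we by (rule order_tendstoD)
    then obtain r where r: "r > 0"
      "\<And>z. 0 < Im z \<Longrightarrow> \<bar>Re z - x\<bar> \<le> M * Im z \<Longrightarrow> norm (z - x) < r \<Longrightarrow> R z < e"
      using M by (rule eventually_ntE) blast
    have "norm ((z - x) * G z) \<le> R z" if z: "0 < Im z" "\<bar>Re z - x\<bar> \<le> M * Im z" for z
    proof -
      have zU: "z \<in> upper_half_plane" using z by (simp add: upper_half_plane_def)
      have "norm (z - x) \<le> \<bar>Re (z - x)\<bar> + \<bar>Im (z - x)\<bar>" by (rule cmod_le)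
      then have C: "norm (z - x) \<le> (M + 1) * Im z" using z by (simp add: algebra_simps)
      have ImGw: "0 \<le> Im (G w)" and ImGz: "0 \<le> Im (G z)" using nevanlinnaD(2)[OF G] w zU by auto
      have Rpos: "0 \<le> (M + 1) * ((norm (z - cnj w))\<^sup>2 * (Im (G w) / Im w))"
        using M ImGw Imw by simp
      define a where "a = norm (G z)"
      define b where "b = norm (G w)"
      show ?thesis
      proof (cases "a \<le> 2 * b")
        case True
        have "norm ((z - x) * G z) = norm (z - x) * a" by (simp add: norm_mult a_def)
        also have "\<dots> \<le> norm (z - x) * (2 * b)" using True by (intro mult_left_mono) auto
        also have "\<dots> \<le> R z" using Rpos by (simp add: R_def b_def)
        finally show ?thesis .
      next
        case False
        have b0: "b \<ge> 0" by (simp add: b_def)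
        have a0: "a > 0" using False b0 by simp
        have "a - b \<le> norm (G z - cnj (G w))"
          unfolding a_def b_def using norm_triangle_ineq2[of "G z" "cnj (G w)"] by simp
        then have "(a - b)\<^sup>2 \<le> (norm (G z - cnj (G w)))\<^sup>2" using False b0 by (intro power_mono) auto
        \<comment> \<open>Of the square only \<open>a * (a - 2 * b)\<close> is kept: its factor
          \<open>a\<close> cancels against the bound \<open>Im (G z) \<le> a\<close> on the
          right.\<close>
        then have "(a * (a - 2 * b)) * (Im z * Im w) \<le> (norm (G z - cnj (G w)))\<^sup>2 * (Im z * Im w)"
          using z Imw by (intro mult_right_mono) (auto simp: power2_eq_square algebra_simps intro: order_trans[rotated])
        also have "\<dots> \<le> (norm (z - cnj w))\<^sup>2 * (Im (G z) * Im (G w))"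
          by (rule Schwarz_Pick_nevanlinna[OF G zU w])
        also have "\<dots> \<le> (norm (z - cnj w))\<^sup>2 * (a * Im (G w))"
          using ImGw abs_Im_le_cmod[of "G z"] by (intro mult_left_mono mult_right_mono) (auto simp: a_def)
        finally have "a * ((a - 2 * b) * (Im z * Im w)) \<le> a * ((norm (z - cnj w))\<^sup>2 * Im (G w))"
          by (simp add: mult_ac)
        then have "(a - 2 * b) * (Im z * Im w) \<le> (norm (z - cnj w))\<^sup>2 * Im (G w)"
          using a0 by simp
        then have le: "(a - 2 * b) * Im z \<le> (norm (z - cnj w))\<^sup>2 * (Im (G w) / Im w)"
          using Imw by (simp add: field_simps)
        have "norm (z - x) * (a - 2 * b) \<le> ((M + 1) * Im z) * (a - 2 * b)"
          using C False by (intro mult_right_mono) auto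
        also have "\<dots> = (M + 1) * ((a - 2 * b) * Im z)" by simp
        also have "\<dots> \<le> (M + 1) * ((norm (z - cnj w))\<^sup>2 * (Im (G w) / Im w))"
          using le M by (intro mult_left_mono) auto
        finally show ?thesis
          unfolding R_def norm_mult a_def b_def by (simp add: algebra_simps)
      qed
    qed
    then show "\<exists>r>0. \<forall>z. 0 < Im z \<longrightarrow> \<bar>Re z - x\<bar> \<le> M * Im z \<longrightarrow> norm (z - x) < r \<longrightarrow>
        norm ((z - x) * G z - 0) < e"
      using r by (intro exI[of _ r]) (auto intro: order.strict_trans1)
  qed
  then have "((\<lambda>z. (z - x) * G z - m) \<longlongrightarrow> 0 - complex_of_real m) (nt x)" by (intro tendsto_intros)
  moreover have "eventually (\<lambda>z. (z - x) * G z - m = (z - x) * f z) (nt x)"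
    using eventually_nt_upper
  proof eventually_elim
    case (elim z)
    then show ?case using zx[OF elim] by (simp add: G_def field_simps)
  qed
  ultimately have "((\<lambda>z. (z - x) * f z) \<longlongrightarrow> 0 - complex_of_real m) (nt x)" by (rule Lim_transform_eventually)
  then show thesis using that[OF m0] by simp
qed

text \<open>Julia--Caratheodory: unless \<open>f\<close> is constantly \<open>\<eta>\<close>, the
  function \<open>- 1 / (f - \<eta>)\<close> is again Nevanlinna, and its residue \<open>- m\<close>
  makes the difference quotient tend to \<open>1 / m\<close>, infinite if \<open>m = 0\<close>. The
  infinite case records \<open>f z \<noteq> \<eta>\<close> because division by zero would yield
  0.\<close>

lemma nevanlinna_boundary_cases:
  assumes f: "f \<in> nevanlinna"
  obtains D :: real where "0 \<le> D" "((\<lambda>z. (f z - complex_of_real \<eta>) / (z - x)) \<longlongrightarrow> D) (nt x)"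
  | "eventually (\<lambda>z. f z \<noteq> complex_of_real \<eta>) (nt x)"
    "((\<lambda>z. (z - x) / (f z - complex_of_real \<eta>)) \<longlongrightarrow> 0) (nt x)"
proof (cases "\<exists>w\<in>upper_half_plane. f w = complex_of_real \<eta>")
  case True
  then obtain w where w: "w \<in> upper_half_plane" "f w = complex_of_real \<eta>" by blast
  have "eventually (\<lambda>z. 0 = (f z - complex_of_real \<eta>) / (z - x)) (nt x)"
    using eventually_nt_upper by eventually_elim (use nevanlinna_constant[OF f w(1)] w in auto)
  then have "((\<lambda>z. (f z - complex_of_real \<eta>) / (z - x)) \<longlongrightarrow> complex_of_real 0) (nt x)"
    by (intro Lim_transform_eventually[OF tendsto_const]) simp
  then show thesis using that(1)[of 0] by simp
next
  case False
  define g where "g = (\<lambda>z. - 1 / (f z - complex_of_real \<eta>))"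
  have "g \<in> nevanlinna"
    unfolding nevanlinna_def
  proof (intro CollectI conjI ballI)
    show "g holomorphic_on upper_half_plane"
      unfolding g_def using False nevanlinnaD(1)[OF f] by (auto intro!: holomorphic_intros)
    show "0 \<le> Im (g z)" if "z \<in> upper_half_plane" for z
      using nevanlinnaD(2)[OF f that] by (simp add: g_def Im_divide)
  qed
  then obtain m where m: "0 \<le> m" "((\<lambda>z. (z - x) * g z) \<longlongrightarrow> - complex_of_real m) (nt x)"
    by (rule nevanlinna_residue[where x = x])
  have lim: "((\<lambda>z. (z - x) / (f z - complex_of_real \<eta>)) \<longlongrightarrow> m) (nt x)"
    using tendsto_minus[OF m(2)] by (simp add: g_def)
  have ne: "eventually (\<lambda>z. f z \<noteq> complex_of_real \<eta>) (nt x)"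
    using eventually_nt_upper by eventually_elim (use False in auto)
  show thesis
  proof (cases "m = 0")
    case True
    then show thesis using that(2) ne lim by simp
  next
    case False
    have "((\<lambda>z. inverse ((z - x) / (f z - complex_of_real \<eta>))) \<longlongrightarrow> inverse (complex_of_real m)) (nt x)"
      using lim False by (intro tendsto_intros) auto
    then have "((\<lambda>z. (f z - complex_of_real \<eta>) / (z - x)) \<longlongrightarrow> complex_of_real (inverse m)) (nt x)"
      by simp
    then show thesis using that(1)[of "inverse m"] m(1) by simp
  qed
qed

lemma nev_kernel_diag: "nev_kernel f z z = complex_of_real (Im (f z) / Im z)"
proof -
  have "a - cnj a = 2 * Im a * \<i>" for a by (simp add: complex_eq_iff)
  then show ?thesis by (simp add: nev_kernel_def)
qed

text \<open>Otherwise the kernel stays below some \<open>B\<close> at points \<open>w\<close>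
  arbitrarily near \<open>x\<close> in some Stolz angle. Letting these tend to \<open>x\<close> in
  Schwarz--Pick bounds \<open>f z - \<eta>\<close> for every \<open>z\<close>; as
  \<open>Im (f z)\<close> is at most the modulus of \<open>f z - \<eta>\<close>, the difference
  quotient is at most \<open>B\<close> on the vertical ray, which contradicts its being
  infinite.\<close>

lemma nev_kernel_tendsto_infinity:
  assumes f: "f \<in> nevanlinna" and \<eta>: "(f \<longlongrightarrow> complex_of_real \<eta>) (nt x)"
    and ne: "eventually (\<lambda>z. f z \<noteq> complex_of_real \<eta>) (nt x)"
    and lim: "((\<lambda>z. (z - x) / (f z - complex_of_real \<eta>)) \<longlongrightarrow> 0) (nt x)"
  shows "filterlim (\<lambda>z. nev_kernel f z z) at_infinity (nt x)"
proof (rule ccontr)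
  assume "\<not> ?thesis"
  then obtain B where B: "B > 0" and "\<not> eventually (\<lambda>z. B \<le> norm (nev_kernel f z z)) (nt x)"
    unfolding filterlim_at_infinity[OF order_refl] by auto
  then have fr: "frequently (\<lambda>w. norm (nev_kernel f w w) < B) (nt x)"
    by (simp add: frequently_def not_less)
  have bound: "(norm (f z - \<eta>))\<^sup>2 * Im z \<le> (norm (z - x))\<^sup>2 * (Im (f z) * B)"
    if z: "z \<in> upper_half_plane" for z
  proof (rule ccontr)
    assume neg: "\<not> ?thesis"
    define F where "F = (\<lambda>w. (norm (z - cnj w))\<^sup>2 * (Im (f z) * B) - (norm (f z - cnj (f w)))\<^sup>2 * Im z)"
    have "(F \<longlongrightarrow> (norm (z - cnj (complex_of_real x)))\<^sup>2 * (Im (f z) * B)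
        - (norm (f z - cnj (complex_of_real \<eta>)))\<^sup>2 * Im z) (nt x)"
      unfolding F_def by (intro tendsto_intros tendsto_nt \<eta>)
    moreover have "(norm (z - cnj (complex_of_real x)))\<^sup>2 * (Im (f z) * B)
        - (norm (f z - cnj (complex_of_real \<eta>)))\<^sup>2 * Im z < 0" using neg by simp
    ultimately have "eventually (\<lambda>w. F w < 0) (nt x)" by (rule order_tendstoD)
    then have "eventually (\<lambda>w. \<not> norm (nev_kernel f w w) < B) (nt x)"
      using eventually_nt_upper
    proof eventually_elim
      case (elim w)
      then have Imw: "Im w > 0" by (simp add: upper_half_plane_def)
      show ?case
      proof
        assume "norm (nev_kernel f w w) < B"
        then have "Im (f w) / Im w < B"
          using Imw nevanlinnaD(2)[OF f elim(2)] by (simp add: nev_kernel_diag del: of_real_divide)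
        then have "Im (f w) \<le> B * Im w" using Imw by (simp add: field_simps)
        then have "(norm (z - cnj w))\<^sup>2 * (Im (f z) * Im (f w)) \<le> (norm (z - cnj w))\<^sup>2 * (Im (f z) * (B * Im w))"
          using nevanlinnaD(2)[OF f z] by (intro mult_left_mono) auto
        then have "((norm (f z - cnj (f w)))\<^sup>2 * Im z) * Im w \<le> ((norm (z - cnj w))\<^sup>2 * (Im (f z) * B)) * Im w"
          using Schwarz_Pick_nevanlinna[OF f z elim(2)] by (simp add: mult_ac)
        then have "F w \<ge> 0" using Imw by (simp add: F_def)
        then show False using elim by simp
      qed
    qed
    then show False using fr by (simp add: frequently_def)
  qed
  \<comment> \<open>Half of the bound \<open>1 / B\<close> is enough: it gives
    \<open>r * B < a\<close>, against \<open>a \<le> (r / 2) * B\<close> from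
    \<open>bound\<close>.\<close>
  have "eventually (\<lambda>z. norm ((z - x) / (f z - complex_of_real \<eta>)) < 1 / (2 * B) \<and> f z \<noteq> complex_of_real \<eta>) (nt x)"
    using lim B ne unfolding tendsto_iff by (intro eventually_conj) (auto simp: dist_norm)
  then obtain r where r: "r > 0" and R: "\<And>z. 0 < Im z \<Longrightarrow> \<bar>Re z - x\<bar> \<le> 1 * Im z \<Longrightarrow> norm (z - x) < r \<Longrightarrow>
      norm ((z - x) / (f z - complex_of_real \<eta>)) < 1 / (2 * B) \<and> f z \<noteq> complex_of_real \<eta>"
    by (rule eventually_ntE[of _ _ 1], simp, blast)
  define z where "z = Complex x (r / 2)"
  have zx: "z - x = \<i> * (r / 2)" by (simp add: z_def complex_eq_iff)
  have nzx: "norm (z - x) = r / 2" unfolding zx using r by (simp add: norm_mult)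
  have zU: "z \<in> upper_half_plane" using r by (simp add: z_def upper_half_plane_def)
  have Rz: "norm (z - x) / norm (f z - \<eta>) < 1 / (2 * B)" "f z \<noteq> \<eta>"
    using R[of z] r nzx by (auto simp: z_def norm_divide)
  define a where "a = norm (f z - \<eta>)"
  have a: "a > 0" using Rz(2) by (simp add: a_def)
  have "a\<^sup>2 * (r / 2) \<le> (r / 2)\<^sup>2 * (Im (f z) * B)"
    using bound[OF zU] unfolding nzx a_def by (simp add: z_def)
  also have "\<dots> \<le> (r / 2)\<^sup>2 * (a * B)"
    using abs_Im_le_cmod[of "f z - \<eta>"] B by (intro mult_left_mono mult_right_mono) (auto simp: a_def)
  finally have "(a * (r / 2)) * a \<le> (a * (r / 2)) * ((r / 2) * B)"
    by (simp add: power2_eq_square mult_ac)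
  then have "a \<le> (r / 2) * B" using a r by simp
  moreover have "(r / 2) / a < 1 / (2 * B)" using Rz(1) unfolding nzx a_def .
  then have "r * B < a" using a B by (simp add: field_simps)
  ultimately show False using r B mult_pos_pos[OF r B] by simp
qed

subsection \<open>Finiteness of zeros via the Schur algorithm\<close>

text \<open>On the real line both sides are squared moduli. Conjugating coefficients makes their
  difference a polynomial, which vanishes at all real numbers and so everywhere.\<close>

lemma poly_reflect_eq:
  fixes a b :: "complex poly"
  assumes "\<And>t::real. norm (poly a t) = norm (poly b t)"
  shows "poly a z * cnj (poly a (cnj z)) = poly b z * cnj (poly b (cnj z))"
proof -
  define p where "p = a * map_poly cnj a - b * map_poly cnj b"
  have cnj': "poly (map_poly cnj q) s = cnj (poly q (cnj s))" for q :: "complex poly" and s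
    using poly_cnj[of q "cnj s"] by simp
  have p: "poly p s = poly a s * cnj (poly a (cnj s)) - poly b s * cnj (poly b (cnj s))" for s
    by (simp add: p_def cnj')
  have "poly p (complex_of_real t) = 0" for t
    using assms[of t] by (simp add: p complex_norm_square[symmetric])
  then have "range complex_of_real \<subseteq> {s. poly p s = 0}" by auto
  moreover have "infinite (range complex_of_real)"
    by (simp add: finite_image_iff inj_on_def infinite_UNIV_char_0)
  ultimately have "p = 0" using poly_roots_finite[of p] infinite_super by blast
  then show ?thesis using p[of z] by simp
qed

lemma poly_div_linear:
  fixes a :: "'a::idom poly"
  assumes "poly a c = 0" "degree a \<le> Suc n"
  obtains q where "a = [:- c, 1:] * q" "degree q \<le> n"
proof -
  obtain q where q: "a = [:- c, 1:] * q" using assms(1) by (auto simp: poly_eq_0_iff_dvd)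
  have "degree q \<le> n"
  proof (cases "q = 0")
    case False
    then have "degree a = Suc (degree q)" by (simp add: q degree_mult_eq del: mult_pCons_left)
    then show ?thesis using assms(2) by simp
  qed simp
  then show thesis using that q by blast
qed

lemma norm_disc_cayley_le:
  fixes a s :: complex
  assumes "norm a \<le> 1" "norm s < 1"
  shows "norm ((a - s) / (1 - cnj s * a)) \<le> 1" "1 - cnj s * a \<noteq> 0"
proof -
  have "norm (cnj s * a) < 1"
    using assms mult_left_le[of "norm a" "norm s"] by (simp add: norm_mult)
  then show nz: "1 - cnj s * a \<noteq> 0" by auto
  have "(norm (1 - cnj s * a))\<^sup>2 - (norm (a - s))\<^sup>2 = (1 - (norm a)\<^sup>2) * (1 - (norm s)\<^sup>2)"
    unfolding cmod_power2 by (simp add: power2_eq_square algebra_simps)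
  also have "\<dots> \<ge> 0" using assms by (intro mult_nonneg_nonneg) (auto simp: power_le_one_iff abs_square_le_1)
  finally have "norm (a - s) \<le> norm (1 - cnj s * a)" by (intro power2_le_imp_le[OF _ norm_ge_zero]) linarith
  then show "norm ((a - s) / (1 - cnj s * a)) \<le> 1"
    unfolding norm_divide using nz by (metis divide_le_eq_1_pos zero_less_norm_iff)
qed

text \<open>The disc automorphism sending \<open>s\<close> to 0 is applied to \<open>f\<close>, and
  the Blaschke factor of the resulting zero at \<open>w\<close> is divided out; Schwarz's lemma
  keeps the modulus below 1. The equation is multiplied out so that it holds at \<open>w\<close>
  too.\<close>

lemma schur_step:
  assumes holo: "f holomorphic_on upper_half_plane"
    and le: "\<And>z. z \<in> upper_half_plane \<Longrightarrow> norm (f z) \<le> 1"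
    and w: "w \<in> upper_half_plane" and s: "s = f w" "norm s < 1"
  obtains g where "g holomorphic_on upper_half_plane" "\<And>z. z \<in> upper_half_plane \<Longrightarrow> norm (g z) \<le> 1"
    "\<And>z. z \<in> upper_half_plane \<Longrightarrow> g z * (1 - cnj s * f z) * (z - w) = (f z - s) * (z - cnj w)"
proof -
  define h where "h = (\<lambda>z. if z = w then deriv f w else (f z - f w) / (z - w))"
  define g where "g = (\<lambda>z. h z * (z - cnj w) / (1 - cnj s * f z))"
  have nz: "1 - cnj s * f z \<noteq> 0" if "z \<in> upper_half_plane" for z
    using norm_disc_cayley_le(2)[OF le[OF that] s(2)] .
  have holh: "h holomorphic_on upper_half_plane"
    unfolding h_def using pole_lemma[OF holo] w open_upper_half_plane by (simp add: interior_open)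
  have holg: "g holomorphic_on upper_half_plane"
    unfolding g_def using nz by (auto intro!: holomorphic_intros holh holo)
  have holc: "(\<lambda>z. (f z - s) / (1 - cnj s * f z)) holomorphic_on upper_half_plane"
    using nz by (auto intro!: holomorphic_intros holo)
  have g1: "norm (g z) \<le> 1" if z: "z \<in> upper_half_plane" "z \<noteq> w" for z
  proof -
    have "norm ((f z - s) / (1 - cnj s * f z)) * norm (z - cnj w) \<le> norm (z - w)"
      by (rule Schwarz_upper_half_plane[OF holc _ w _ z(1)]) (auto simp: s(1)[symmetric] intro!: norm_disc_cayley_le le s(2))
    moreover have "norm (g z) = norm ((f z - s) / (1 - cnj s * f z)) * norm (z - cnj w) / norm (z - w)"
      using z(2) unfolding g_def h_def norm_divide norm_mult s(1) by (simp add: norm_divide)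
    ultimately show ?thesis using z(2) by simp
  qed
  \<comment> \<open>The Blaschke factor vanishes at \<open>w\<close>, so the bound there comes by
    continuity from neighbouring points.\<close>
  have "norm (g w) \<le> 1"
  proof (rule tendsto_upperbound)
    have "isCont g w"
      using holg w open_upper_half_plane holomorphic_on_imp_continuous_on continuous_on_eq_continuous_at by blast
    then show "((\<lambda>z. norm (g z)) \<longlongrightarrow> norm (g w)) (at w)" by (intro tendsto_norm) (simp add: isCont_def)
    have "eventually (\<lambda>z. z \<in> upper_half_plane) (at w)"
      using open_upper_half_plane w by (rule eventually_at_in_open')
    then show "eventually (\<lambda>z. norm (g z) \<le> 1) (at w)"
      using eventually_neq_at_within[of w w UNIV] by eventually_elim (rule g1)
  qed simp
  then have "norm (g z) \<le> 1" if "z \<in> upper_half_plane" for z using g1 that by blast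
  moreover have "g z * (1 - cnj s * f z) * (z - w) = (f z - s) * (z - cnj w)" if "z \<in> upper_half_plane" for z
    using nz[OF that] by (simp add: g_def h_def s(1)[symmetric])
  ultimately show thesis using that[OF holg] by blast
qed

text \<open>Induction on the degree: one Schur step at a common value of \<open>f\<close> and \<open>a / b\<close> lowers the
  degree of the rational function \<open>a / b\<close>, which is unimodular on the real line.\<close>

lemma schur_eq_rational:
  fixes a b :: "complex poly"
  assumes "f holomorphic_on upper_half_plane" "\<And>z. z \<in> upper_half_plane \<Longrightarrow> norm (f z) \<le> 1"
    "\<And>t::real. norm (poly a t) = norm (poly b t)" "degree a \<le> n" "degree b \<le> n"
    "infinite {z \<in> upper_half_plane. poly b z * f z = poly a z}"
    "z \<in> upper_half_plane"
  shows "poly b z * f z = poly a z"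
  using assms
proof (induction n arbitrary: f a b z)
  case (0 f a b z)
  obtain w where w: "w \<in> upper_half_plane" "poly b w * f w = poly a w"
    using 0(6) by (metis (mono_tags, lifting) empty_Collect_eq finite.emptyI)
  obtain a0 b0 where ab: "a = [:a0:]" "b = [:b0:]" using 0(4,5) by (metis degree_0_id le_zero_eq)
  \<comment> \<open>Unless both constants vanish, \<open>f\<close> attains modulus 1 at
    \<open>w\<close> and is constant.\<close>
  have n: "norm a0 = norm b0" using 0(3)[of 0] by (simp add: ab)
  show ?case
  proof (cases "b0 = 0")
    case True
    then show ?thesis using n by (simp add: ab)
  next
    case False
    have "norm b0 * norm (f w) = norm a0" using w(2) by (simp add: ab norm_mult[symmetric])
    then have "norm (f w) = 1" using n False by simp
    then have "f z = f w" using holomorphic_maximum_upper[OF 0(1) _ w(1) 0(7)] 0(2) by simp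
    then show ?thesis using w by (simp add: ab)
  qed
next
  case (Suc n f a b z)
  let ?Z = "{z \<in> upper_half_plane. poly b z * f z = poly a z}"
  obtain w where w: "w \<in> upper_half_plane" "poly b w * f w = poly a w"
    using Suc.prems(6) by (metis (mono_tags, lifting) empty_Collect_eq finite.emptyI)
  have Imw: "Im w > 0" using w by (simp add: upper_half_plane_def)
  have tw: "complex_of_real t \<noteq> w" "complex_of_real t \<noteq> cnj w" for t
    using Imw by (auto simp: complex_eq_iff)
  have inf: "infinite (?Z - {w})" using Suc.prems(6) by simp
  define s where "s = f w"
  consider "norm s = 1" | "norm s < 1" "poly b w = 0" | "norm s < 1" "poly b w \<noteq> 0"
    using Suc.prems(2)[OF w(1)] unfolding s_def by linarith
  then show ?case
  proof cases
    case 1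
    then have const: "f t = s" if "t \<in> upper_half_plane" for t
      using holomorphic_maximum_upper[OF Suc.prems(1) _ w(1) that] Suc.prems(2) by (simp add: s_def)
    have "?Z \<subseteq> {t. poly (Polynomial.smult s b - a) t = 0}" using const by (auto simp: mult.commute)
    then have "Polynomial.smult s b - a = 0" using poly_roots_finite Suc.prems(6) infinite_super by blast
    then have "poly (Polynomial.smult s b - a) z = 0" by simp
    then show ?thesis using const[OF Suc.prems(7)] by (simp add: mult.commute)
  next
    \<comment> \<open>A common zero of \<open>a\<close> and \<open>b\<close> is cancelled: the
      degrees drop and \<open>f\<close> stays.\<close>
    case 2
    then have "poly a w = 0" using w by simp
    then obtain a' where a': "a = [:- w, 1:] * a'" "degree a' \<le> n" using poly_div_linear Suc.prems(4) by blast
    obtain b' where b': "b = [:- w, 1:] * b'" "degree b' \<le> n" using poly_div_linear Suc.prems(5) 2 by blast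
    have pa: "poly a t = (t - w) * poly a' t" and pb: "poly b t = (t - w) * poly b' t" for t
      by (simp_all add: a' b' algebra_simps)
    have "poly b' z * f z = poly a' z"
    proof (rule Suc.IH[OF Suc.prems(1,2) _ a'(2) b'(2) _ Suc.prems(7)])
      show "norm (poly a' (complex_of_real t)) = norm (poly b' (complex_of_real t))" for t
        using Suc.prems(3)[of t] tw[of t] by (simp add: pa pb norm_mult)
      have "?Z - {w} \<subseteq> {z \<in> upper_half_plane. poly b' z * f z = poly a' z}"
        by (auto simp: pa pb)
      then show "infinite {z \<in> upper_half_plane. poly b' z * f z = poly a' z}"
        using inf infinite_super by blast
    qed
    then show ?thesis by (simp add: pa pb)
  next
    case 3
    \<comment> \<open>By reflection \<open>b - cnj s * a\<close> vanishes at \<open>cnj w\<close>,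
      just as \<open>a - s * b\<close> vanishes at \<open>w\<close>. Dividing out these two zeros
      lowers both degrees and matches the Schur step for \<open>f\<close>.\<close>
    have "poly b w * (s * cnj (poly a (cnj w)) - cnj (poly b (cnj w))) = 0"
    proof -
      have "poly b w * (s * cnj (poly a (cnj w)) - cnj (poly b (cnj w))) =
          (poly b w * f w) * cnj (poly a (cnj w)) - poly b w * cnj (poly b (cnj w))"
        by (simp add: s_def algebra_simps)
      then show ?thesis using poly_reflect_eq[OF Suc.prems(3), of w] by (simp add: w(2))
    qed
    then have "s * cnj (poly a (cnj w)) = cnj (poly b (cnj w))" using 3 by simp
    then have "cnj (s * cnj (poly a (cnj w))) = cnj (cnj (poly b (cnj w)))" by (rule arg_cong)
    then have bw: "poly (b - Polynomial.smult (cnj s) a) (cnj w) = 0" by simp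
    have aw: "poly (a - Polynomial.smult s b) w = 0" using w(2) by (simp add: s_def mult.commute)
    have "degree (a - Polynomial.smult s b) \<le> Suc n" "degree (b - Polynomial.smult (cnj s) a) \<le> Suc n"
      using Suc.prems(4,5) by (auto intro!: degree_diff_le degree_smult_le[THEN order_trans])
    then obtain a' b' where a': "a - Polynomial.smult s b = [:- w, 1:] * a'" "degree a' \<le> n"
      and b': "b - Polynomial.smult (cnj s) a = [:- cnj w, 1:] * b'" "degree b' \<le> n"
      using poly_div_linear aw bw by metis
    have pa: "poly a t - s * poly b t = (t - w) * poly a' t" for t
      using arg_cong[OF a'(1), of "\<lambda>p. poly p t"] by (simp add: algebra_simps)
    have pb: "poly b t - cnj s * poly a t = (t - cnj w) * poly b' t" for t
      using arg_cong[OF b'(1), of "\<lambda>p. poly p t"] by (simp add: algebra_simps)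
    obtain g where g: "g holomorphic_on upper_half_plane" "\<And>z. z \<in> upper_half_plane \<Longrightarrow> norm (g z) \<le> 1"
      "\<And>z. z \<in> upper_half_plane \<Longrightarrow> g z * (1 - cnj s * f z) * (z - w) = (f z - s) * (z - cnj w)"
      using schur_step[OF Suc.prems(1,2) w(1) s_def 3(1)] by blast
    \<comment> \<open>Away from \<open>w\<close> the other factors do not vanish, so
      \<open>g\<close> agrees with \<open>a' / b'\<close> exactly where \<open>f\<close> agrees with
      \<open>a / b\<close>.\<close>
    have key: "(poly b' t * g t - poly a' t) * ((t - cnj w) * (t - w) * (1 - cnj s * f t))
        = (1 - cnj s * s) * (poly b t * f t - poly a t) * (t - cnj w)" if "t \<in> upper_half_plane" for t
    proof -
      have "(poly b' t * g t - poly a' t) * ((t - cnj w) * (t - w) * (1 - cnj s * f t))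
        = ((t - cnj w) * poly b' t) * (g t * (1 - cnj s * f t) * (t - w))
          - ((t - w) * poly a' t) * (t - cnj w) * (1 - cnj s * f t)" by (simp add: algebra_simps)
      also have "\<dots> = (poly b t - cnj s * poly a t) * ((f t - s) * (t - cnj w))
          - (poly a t - s * poly b t) * (t - cnj w) * (1 - cnj s * f t)"
        unfolding g(3)[OF that] pa pb ..
      also have "\<dots> = (1 - cnj s * s) * (poly b t * f t - poly a t) * (t - cnj w)"
        by (simp add: algebra_simps)
      finally show ?thesis .
    qed
    have tcw: "t - cnj w \<noteq> 0" if "t \<in> upper_half_plane" for t
    proof
      assume "t - cnj w = 0"
      then have "Im (t - cnj w) = 0" by simp
      then show False using that Imw by (simp add: upper_half_plane_def)
    qed
    have nz: "1 - cnj s * f t \<noteq> 0" if "t \<in> upper_half_plane" for t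
      by (rule norm_disc_cayley_le(2)[OF Suc.prems(2)[OF that] 3(1)])
    have "poly b' z * g z = poly a' z"
    proof (rule Suc.IH[OF g(1,2) _ a'(2) b'(2) _ Suc.prems(7)])
      show "norm (poly a' (complex_of_real t)) = norm (poly b' (complex_of_real t))" for t
      proof -
        let ?A = "poly a (complex_of_real t)" and ?B = "poly b (complex_of_real t)"
        have "(norm (?A - s * ?B))\<^sup>2 = (norm (?B - cnj s * ?A))\<^sup>2 + ((norm ?A)\<^sup>2 - (norm ?B)\<^sup>2) * (1 - (norm s)\<^sup>2)"
          unfolding cmod_power2 by (simp add: power2_eq_square algebra_simps)
        then have "norm (?A - s * ?B) = norm (?B - cnj s * ?A)"
          unfolding Suc.prems(3) by (simp add: power2_eq_iff_nonneg)
        moreover have "norm (complex_of_real t - cnj w) = norm (complex_of_real t - w)"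
          by (metis complex_cnj_complex_of_real complex_cnj_diff complex_mod_cnj)
        ultimately show ?thesis unfolding pa pb norm_mult using tw[of t] by simp
      qed
      have "?Z - {w} \<subseteq> {z \<in> upper_half_plane. poly b' z * g z = poly a' z}"
      proof
        fix t assume t: "t \<in> ?Z - {w}"
        then have tU: "t \<in> upper_half_plane" by simp
        have "(poly b' t * g t - poly a' t) * ((t - cnj w) * (t - w) * (1 - cnj s * f t)) = 0"
          unfolding key[OF tU] using t by simp
        then have "poly b' t * g t - poly a' t = 0" using tcw[OF tU] nz[OF tU] t by auto
        then show "t \<in> {z \<in> upper_half_plane. poly b' z * g z = poly a' z}" using tU by simp
      qed
      then show "infinite {z \<in> upper_half_plane. poly b' z * g z = poly a' z}"
        using inf infinite_super by blast
    qed
    then have "(1 - cnj s * s) * (poly b z * f z - poly a z) * (z - cnj w) = 0"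
      using key[OF Suc.prems(7)] by simp
    moreover have "1 - cnj s * s \<noteq> 0"
      using norm_disc_cayley_le(2)[of s s] 3 by simp
    ultimately show ?thesis using tcw[OF Suc.prems(7)] by simp
  qed
qed

text \<open>The Cayley transform turns the value \<open>- b / a\<close> into \<open>A / B\<close>.
  On the real line \<open>A\<close> and \<open>B\<close> are conjugate, hence of equal modulus, and
  the result for functions bounded by 1 applies.\<close>

lemma nevanlinna_eq_rational:
  fixes a b :: "complex poly"
  assumes f: "f \<in> nevanlinna"
    and real: "\<And>t::real. poly a t \<in> \<real>" "\<And>t::real. poly b t \<in> \<real>"
    and inf: "infinite {z \<in> upper_half_plane. poly a z * f z + poly b z = 0}"
    and z: "z \<in> upper_half_plane"
  shows "poly a z * f z + poly b z = 0"
proof -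
  define g where "g = (\<lambda>z. (f z - \<i>) / (f z - cnj \<i>))"
  define A where "A = - Polynomial.smult \<i> a - b"
  define B where "B = Polynomial.smult \<i> a - b"
  have eq: "poly B t * g t = poly A t \<longleftrightarrow> poly a t * f t + poly b t = 0" if t: "t \<in> upper_half_plane" for t
  proof -
    have nz: "f t - cnj \<i> \<noteq> 0" using norm_cayley_le(2)[OF nevanlinnaD(2)[OF f t], of \<i>] by simp
    have "(poly B t * g t - poly A t) * (f t - cnj \<i>) = poly B t * (f t - \<i>) - poly A t * (f t - cnj \<i>)"
      using nz by (simp add: g_def left_diff_distrib)
    also have "\<dots> = 2 * \<i> * (poly a t * f t + poly b t)"
      by (simp add: A_def B_def algebra_simps)
    finally have "(poly B t * g t - poly A t) * (f t - cnj \<i>) = 2 * \<i> * (poly a t * f t + poly b t)" .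
    then show ?thesis using nz by (metis complex_i_not_zero eq_iff_diff_eq_0 mult_eq_0_iff zero_neq_numeral)
  qed
  have "poly B z * g z = poly A z"
  proof (rule schur_eq_rational[OF _ _ _ _ _ _ z])
    show "g holomorphic_on upper_half_plane"
      unfolding g_def by (rule holomorphic_cayley_nevanlinna[OF f]) simp
    show "norm (g t) \<le> 1" if "t \<in> upper_half_plane" for t
      using norm_cayley_le(1)[OF nevanlinnaD(2)[OF f that], of \<i>] by (simp add: g_def)
    show "norm (poly A (complex_of_real t)) = norm (poly B (complex_of_real t))" for t
    proof -
      obtain u v where uv: "poly a (complex_of_real t) = complex_of_real u" "poly b (complex_of_real t) = complex_of_real v"
        using real Reals_cases by metis
      show ?thesis by (simp add: A_def B_def uv cmod_def)
    qed
    show "degree A \<le> max (degree A) (degree B)" "degree B \<le> max (degree A) (degree B)" by auto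
    have "{z \<in> upper_half_plane. poly B z * g z = poly A z} = {z \<in> upper_half_plane. poly a z * f z + poly b z = 0}"
      using eq by auto
    then show "infinite {z \<in> upper_half_plane. poly B z * g z = poly A z}" using inf by simp
  qed
  then show ?thesis using eq[OF z] by simp
qed

text \<open>Multiplication by the product of all \<open>z - x j\<close>, which has no zero in the
  half plane, turns \<open>V\<close> into an expression linear in \<open>f\<close> whose polynomial
  coefficients are real on the real line.\<close>

lemma nevanlinna_partial_fractions_zeros:
  fixes x a b :: "nat \<Rightarrow> real" and k c :: real and n :: nat
  assumes f: "f \<in> nevanlinna"
  defines "V \<equiv> \<lambda>z. (k + (\<Sum>j<n. a j / (z - complex_of_real (x j)))) * f z + (c + (\<Sum>j<n. b j / (z - complex_of_real (x j))))"
  shows "(\<forall>z\<in>upper_half_plane. V z = 0) \<or> finite {z \<in> upper_half_plane. V z = 0}"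
proof (rule disjCI, intro ballI)
  fix z assume inf: "infinite {z \<in> upper_half_plane. V z = 0}" and z: "z \<in> upper_half_plane"
  define Q where "Q = (\<lambda>S. \<Prod>j\<in>S. [:- complex_of_real (x j), 1:])"
  define P where "P = (\<lambda>(k::real) (a::nat \<Rightarrow> real). Polynomial.smult k (Q {..<n}) + (\<Sum>j<n. Polynomial.smult (a j) (Q ({..<n} - {j}))))"
  have Q: "poly (Q S) t = (\<Prod>j\<in>S. t - x j)" for S t by (simp add: Q_def poly_prod)
  have ne: "t - complex_of_real (x j) \<noteq> 0" if "t \<in> upper_half_plane" for t j
    using that by (auto simp: upper_half_plane_def complex_eq_iff)
  have P: "poly (P k a) t = poly (Q {..<n}) t * (k + (\<Sum>j<n. a j / (t - complex_of_real (x j))))"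
    if "t \<in> upper_half_plane" for t and k :: real and a :: "nat \<Rightarrow> real"
  proof -
    have "poly (Q {..<n}) t * (a j / (t - complex_of_real (x j))) = a j * poly (Q ({..<n} - {j})) t" if "j < n" for j
      unfolding Q using prod.remove[of "{..<n}" j "\<lambda>j. t - x j"] that ne[OF \<open>t \<in> _\<close>, of j] by simp
    then show ?thesis by (simp add: P_def poly_sum distrib_left sum_distrib_left mult.commute)
  qed
  have PR: "poly (P k a) (complex_of_real t) \<in> \<real>" for t and k :: real and a :: "nat \<Rightarrow> real"
    unfolding P_def by (auto simp: poly_sum Q intro!: Reals_add Reals_mult sum_in_Reals prod_in_Reals)
  have Qnz: "poly (Q {..<n}) t \<noteq> 0" if "t \<in> upper_half_plane" for t
    using ne[OF that] by (simp add: Q)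
  have PV: "poly (P k a) t * f t + poly (P c b) t = poly (Q {..<n}) t * V t" if "t \<in> upper_half_plane" for t
    unfolding P[OF that] V_def by (simp add: algebra_simps)
  have "{z \<in> upper_half_plane. V z = 0} \<subseteq> {z \<in> upper_half_plane. poly (P k a) z * f z + poly (P c b) z = 0}"
    using PV by auto
  then have "infinite {z \<in> upper_half_plane. poly (P k a) z * f z + poly (P c b) z = 0}"
    using inf infinite_super by blast
  then have "poly (P k a) z * f z + poly (P c b) z = 0"
    by (rule nevanlinna_eq_rational[OF f PR PR _ z])
  then show "V z = 0" using PV[OF z] Qnz[OF z] by simp
qed

subsection \<open>The parameter near a node\<close>

fun param_pair :: "ext_fun \<Rightarrow> (complex \<Rightarrow> complex) \<times> real" where
  "param_pair None = (\<lambda>_. 1, 0)"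
| "param_pair (Some f) = (f, 1)"

lemma param_pair_nevanlinna: "\<phi> \<in> ext_nevanlinna \<Longrightarrow> fst (param_pair \<phi>) \<in> nevanlinna"
  by (auto simp: ext_nevanlinna_def nevanlinna_def)

lemma tendsto_nt_diff: "((\<lambda>z. z - complex_of_real x) \<longlongrightarrow> 0) (nt x)"
  using tendsto_diff[OF tendsto_nt tendsto_const, of x x] by simp

lemma eventually_nt_neq: "eventually (\<lambda>z. z - complex_of_real x \<noteq> 0) (nt x)"
  using eventually_nt_upper by eventually_elim (auto simp: upper_half_plane_def)

lemma bvalue_if_quotient:
  assumes "((\<lambda>z. (g z - w) / (z - complex_of_real x)) \<longlongrightarrow> d) (nt x)"
  shows "(g \<longlongrightarrow> w) (nt x)"
proof -
  have "((\<lambda>z. (g z - w) / (z - complex_of_real x) * (z - complex_of_real x) + w) \<longlongrightarrow> d * 0 + w) (nt x)"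
    by (intro tendsto_intros assms tendsto_nt_diff)
  moreover have "eventually (\<lambda>z. (g z - w) / (z - complex_of_real x) * (z - complex_of_real x) + w = g z) (nt x)"
    using eventually_nt_neq by eventually_elim simp
  ultimately show ?thesis using Lim_transform_eventually by fastforce
qed

lemma holomorphic_eventually_nt:
  assumes "g holomorphic_on upper_half_plane"
  shows "eventually (\<lambda>z. g field_differentiable at z) (nt x)"
  using eventually_nt_upper
  by eventually_elim (use assms open_upper_half_plane in \<open>auto simp: holomorphic_on_open field_differentiable_def\<close>)

text \<open>The parameter is the pair \<open>(f, k)\<close> in homogeneous coordinates: \<open>k = 1\<close>, or \<open>f = 1\<close> and \<open>k = 0\<close>
  for the parameter \<open>\<infinity>\<close>. The scale \<open>\<rho>\<close> normalises \<open>e f - c k\<close> against \<open>(z - x) f\<close> and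
  \<open>(z - x) k\<close>; up to a positive factor, \<open>p0 : q0\<close> is the derivative at \<open>x\<close> of the parameter or of its negative
  reciprocal, infinite if \<open>q0 = 0\<close>.\<close>

definition asymptotics :: "(complex \<Rightarrow> complex) \<Rightarrow> real \<Rightarrow> real \<Rightarrow> real \<Rightarrow> real \<Rightarrow> (complex \<Rightarrow> complex) \<Rightarrow> real \<Rightarrow> real \<Rightarrow> bool" where
  "asymptotics f k x c e \<rho> p0 q0 \<longleftrightarrow>
     eventually (\<lambda>z. \<rho> z \<noteq> 0) (nt x) \<and>
     ((\<lambda>z. (e * f z - c * k) / \<rho> z) \<longlongrightarrow> complex_of_real p0) (nt x) \<and>
     ((\<lambda>z. (z - x) * f z / \<rho> z) \<longlongrightarrow> complex_of_real (q0 * c)) (nt x) \<and>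
     ((\<lambda>z. (z - x) * k / \<rho> z) \<longlongrightarrow> complex_of_real (q0 * e)) (nt x) \<and>
     (q0 = 0 \<and> p0 = 1 \<or> q0 = 1)"

text \<open>The two outcomes at \<open>\<eta> = c / e\<close> are treated apart. A finite quotient
  \<open>D\<close> gives \<open>p0 = e\<^sup>2 * D\<close> and \<open>q0 = 1\<close>; only the third
  condition can hold, and it says \<open>e\<^sup>2 * D + p > 0\<close>. An infinite quotient gives
  \<open>p0 = 1\<close> and \<open>q0 = 0\<close>, and one of the first two conditions
  holds.\<close>

lemma asymptotics_regular:
  assumes f: "f \<in> nevanlinna" and e: "e \<noteq> 0"
  shows "\<exists>\<rho> p0 q0. asymptotics f 1 x c e \<rho> p0 q0 \<and>
    ((cond_C1 (Some f) x (c / e) \<or> cond_C2 (Some f) x (c / e) \<or> cond_C3 (Some f) x (c / e) p e)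
      \<longleftrightarrow> 0 < p0 + q0 * p)"
proof -
  define \<eta> where "\<eta> = c / e"
  have u: "complex_of_real e * f z - c * complex_of_real 1 = e * (f z - \<eta>)" for z
    using e by (simp add: \<eta>_def field_simps)
  show ?thesis
  proof (cases rule: nevanlinna_boundary_cases[OF f, of \<eta> x])
    case (1 D)
    have val: "(f \<longlongrightarrow> complex_of_real \<eta>) (nt x)" by (rule bvalue_if_quotient[OF 1(2)])
    have der: "(deriv f \<longlongrightarrow> complex_of_real D) (nt x)"
      by (rule deriv_tendsto_nt[OF holomorphic_eventually_nt[OF nevanlinnaD(1)[OF f]] 1(2)])
    have asy: "asymptotics f 1 x c e (\<lambda>z. (z - x) / e) (e\<^sup>2 * D) 1"
      unfolding asymptotics_def
    proof (intro conjI)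
      show "eventually (\<lambda>z. (z - complex_of_real x) / e \<noteq> 0) (nt x)"
        using eventually_nt_neq by eventually_elim (use e in simp)
      have "((\<lambda>z. e\<^sup>2 * ((f z - complex_of_real \<eta>) / (z - x))) \<longlongrightarrow> complex_of_real (e\<^sup>2) * D) (nt x)"
        by (intro tendsto_intros 1(2))
      then show "((\<lambda>z. (e * f z - c * complex_of_real 1) / ((z - x) / e)) \<longlongrightarrow> complex_of_real (e\<^sup>2 * D)) (nt x)"
        unfolding u by (simp add: power2_eq_square mult_ac)
      have "eventually (\<lambda>z. e * f z = (z - x) * f z / ((z - x) / e)) (nt x)"
        using eventually_nt_neq by eventually_elim (use e in simp)
      moreover have "((\<lambda>z. e * f z) \<longlongrightarrow> complex_of_real e * \<eta>) (nt x)" by (intro tendsto_intros val)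
      ultimately have "((\<lambda>z. (z - x) * f z / ((z - x) / e)) \<longlongrightarrow> complex_of_real e * \<eta>) (nt x)"
        by (rule Lim_transform_eventually[rotated])
      then show "((\<lambda>z. (z - x) * f z / ((z - x) / e)) \<longlongrightarrow> complex_of_real (1 * c)) (nt x)"
        using e by (simp add: \<eta>_def)
      have "eventually (\<lambda>z. complex_of_real e = (z - x) * complex_of_real 1 / ((z - x) / e)) (nt x)"
        using eventually_nt_neq by eventually_elim (use e in simp)
      then show "((\<lambda>z. (z - x) * complex_of_real 1 / ((z - x) / e)) \<longlongrightarrow> complex_of_real (1 * e)) (nt x)"
        by (intro Lim_transform_eventually[OF tendsto_const]) simp
    qed simp
    have C1: "\<not> cond_C1 (Some f) x \<eta>"
      using val has_nt_limit_unique unfolding cond_C1_def has_bvalue_def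
      by (auto simp: has_nt_limit_Some[symmetric])
    have C2: "\<not> cond_C2 (Some f) x \<eta>"
    proof
      assume "cond_C2 (Some f) x \<eta>"
      then have "filterlim (\<lambda>z. nev_kernel f z z) at_infinity (nt x)"
        by (simp add: cond_C2_def has_bkernel_def has_nt_limit_None)
      then have "eventually (\<lambda>z. norm (nev_kernel f z z) \<ge> D + 1) (nt x)"
        using 1(1) unfolding filterlim_at_infinity[OF order_refl] by simp
      moreover have "eventually (\<lambda>z. norm ((f z - complex_of_real \<eta>) / (z - x)) < D + 1) (nt x)"
        using tendsto_norm[OF 1(2)] 1(1) by (auto intro: order_tendstoD)
      ultimately have "eventually (\<lambda>z. norm (nev_kernel f z z) \<ge> D + 1 \<and>
          norm ((f z - complex_of_real \<eta>) / (z - x)) < D + 1) (nt x)" by (rule eventually_conj)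
      then obtain r where r: "r > 0" and R: "\<And>z. 0 < Im z \<Longrightarrow> \<bar>Re z - x\<bar> \<le> 1 * Im z \<Longrightarrow> norm (z - x) < r \<Longrightarrow>
          norm (nev_kernel f z z) \<ge> D + 1 \<and> norm ((f z - complex_of_real \<eta>) / (z - x)) < D + 1"
        by (rule eventually_ntE[of _ _ 1], simp, blast)
      define z where "z = Complex x (r / 2)"
      have zx: "z - x = \<i> * (r / 2)" by (simp add: z_def complex_eq_iff)
      have nzx: "norm (z - x) = r / 2" unfolding zx using r by (simp add: norm_mult)
      have z: "norm (nev_kernel f z z) \<ge> D + 1" "norm (f z - \<eta>) / norm (z - x) < D + 1"
        using R[of z] r nzx by (auto simp: z_def norm_divide)
      \<comment> \<open>On the vertical ray \<open>Im z\<close> is the distance to \<open>x\<close>,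
        and \<open>\<eta>\<close> is real, so the difference quotient dominates the kernel.\<close>
      have "norm (nev_kernel f z z) = \<bar>Im (f z)\<bar> / (r / 2)"
        unfolding nev_kernel_diag norm_of_real using r by (simp add: z_def)
      also have "\<dots> \<le> norm (f z - \<eta>) / (r / 2)"
        using abs_Im_le_cmod[of "f z - \<eta>"] r by (intro divide_right_mono) auto
      finally show False using z unfolding nzx by linarith
    qed
    have C3: "cond_C3 (Some f) x \<eta> p e \<longleftrightarrow> - p / e\<^sup>2 < D"
    proof -
      have "has_bderiv (Some f) x (complex_of_real d) \<longleftrightarrow> d = D" for d
        using der has_nt_limit_unique[of "deriv f" x "Some (complex_of_real d)" "Some (complex_of_real D)"]
        by (auto simp: has_bderiv_def has_nt_limit_Some)
      then show ?thesis using val by (auto simp: cond_C3_def has_bvalue_def has_nt_limit_Some)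
    qed
    have "- p / e\<^sup>2 < D \<longleftrightarrow> 0 < e\<^sup>2 * D + 1 * p" using e by (subst pos_divide_less_eq) (auto simp: mult.commute)
    then show ?thesis using asy C1 C2 C3 unfolding \<eta>_def[symmetric] by blast
  next
    case 2
    have asy: "asymptotics f 1 x c e (\<lambda>z. e * (f z - \<eta>)) 1 0"
      unfolding asymptotics_def u
    proof (intro conjI)
      show nz: "eventually (\<lambda>z. e * (f z - complex_of_real \<eta>) \<noteq> 0) (nt x)"
        using 2(1) by eventually_elim (use e in simp)
      have "eventually (\<lambda>z. complex_of_real 1 = e * (f z - complex_of_real \<eta>) / (e * (f z - complex_of_real \<eta>))) (nt x)"
        using nz by eventually_elim simp
      then show "((\<lambda>z. e * (f z - complex_of_real \<eta>) / (e * (f z - complex_of_real \<eta>))) \<longlongrightarrow> complex_of_real 1) (nt x)"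
        by (rule Lim_transform_eventually[OF tendsto_const])
      have lim: "((\<lambda>z. complex_of_real (1 / e) * ((z - x) / (f z - complex_of_real \<eta>))) \<longlongrightarrow> complex_of_real (1 / e) * 0) (nt x)"
        by (rule tendsto_mult[OF tendsto_const 2(2)])
      then show "((\<lambda>z. (z - x) * complex_of_real 1 / (e * (f z - complex_of_real \<eta>))) \<longlongrightarrow> complex_of_real (0 * e)) (nt x)"
        by simp
      have "((\<lambda>z. (z - x) / e) \<longlongrightarrow> 0 / complex_of_real e) (nt x)"
        using e by (intro tendsto_intros tendsto_nt_diff) simp
      moreover have "((\<lambda>z. complex_of_real (\<eta> / e) * ((z - x) / (f z - complex_of_real \<eta>))) \<longlongrightarrow> complex_of_real (\<eta> / e) * 0) (nt x)"
        by (rule tendsto_mult[OF tendsto_const 2(2)])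
      ultimately have "((\<lambda>z. (z - x) / e + complex_of_real (\<eta> / e) * ((z - x) / (f z - complex_of_real \<eta>))) \<longlongrightarrow> 0 / complex_of_real e + complex_of_real (\<eta> / e) * 0) (nt x)"
        by (rule tendsto_add)
      moreover have "eventually (\<lambda>z. (z - x) / e + complex_of_real (\<eta> / e) * ((z - x) / (f z - complex_of_real \<eta>))
          = (z - x) * f z / (e * (f z - complex_of_real \<eta>))) (nt x)"
        using 2(1)
      proof eventually_elim
        case (elim z)
        then have "f z - complex_of_real \<eta> \<noteq> 0" by simp
        then have "(z - x) / e = (z - x) * (f z - \<eta>) / (e * (f z - complex_of_real \<eta>))" by simp
        then show ?case by (simp add: add_divide_distrib[symmetric] algebra_simps)
      qed
      ultimately show "((\<lambda>z. (z - x) * f z / (e * (f z - complex_of_real \<eta>))) \<longlongrightarrow> complex_of_real (0 * c)) (nt x)"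
        using Lim_transform_eventually by fastforce
    qed simp
    have "cond_C1 (Some f) x \<eta> \<or> cond_C2 (Some f) x \<eta>"
    proof (cases "has_bvalue (Some f) x (Some (complex_of_real \<eta>))")
      case True
      then have "(f \<longlongrightarrow> complex_of_real \<eta>) (nt x)" by (simp add: has_bvalue_def has_nt_limit_Some)
      then have "has_bkernel (Some f) x None"
        using nev_kernel_tendsto_infinity[OF f _ 2] by (simp add: has_bkernel_def has_nt_limit_None)
      then show ?thesis using True by (simp add: cond_C2_def)
    next
      case False
      then show ?thesis unfolding cond_C1_def by metis
    qed
    with asy have "asymptotics f 1 x c e (\<lambda>z. e * (f z - \<eta>)) 1 0 \<and>
        ((cond_C1 (Some f) x \<eta> \<or> cond_C2 (Some f) x \<eta> \<or> cond_C3 (Some f) x \<eta> p e) \<longleftrightarrow> 0 < 1 + 0 * p)"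
      by auto
    then show ?thesis unfolding \<eta>_def[symmetric] by blast
  qed
qed

text \<open>For \<open>e = 0\<close> the residue \<open>- m\<close> of \<open>f\<close> takes the
  place of the difference quotient. If \<open>m = 0\<close>, one of the first two conditions holds.
  If \<open>m > 0\<close>, then \<open>f\<close> tends to infinity and the negative reciprocal of
  the residue is \<open>1 / m\<close>, so the third condition says
  \<open>c\<^sup>2 / m + p > 0\<close>.\<close>

lemma asymptotics_singular:
  assumes f: "f \<in> nevanlinna" and c: "c \<noteq> 0"
  shows "\<exists>\<rho> p0 q0. asymptotics f 1 x c 0 \<rho> p0 q0 \<and>
    ((cond_C1_tilde (Some f) x \<or> cond_C2_tilde (Some f) x \<or> cond_C3_tilde (Some f) x p c)
      \<longleftrightarrow> 0 < p0 + q0 * p)"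
proof -
  obtain m where m: "0 \<le> m" "((\<lambda>z. (z - x) * f z) \<longlongrightarrow> - complex_of_real m) (nt x)"
    by (rule nevanlinna_residue[OF f])
  have res: "has_bresidue (Some f) x v \<longleftrightarrow> v = Some (- complex_of_real m)" for v
    unfolding has_bresidue_def using m(2) has_nt_limit_unique
    by (auto simp: has_nt_limit_Some[symmetric])
  show ?thesis
  proof (cases "m = 0")
    case True
    have "asymptotics f 1 x c 0 (\<lambda>_. - c) 1 0"
      unfolding asymptotics_def using c True m(2) tendsto_divide[OF m(2) tendsto_const, of "- complex_of_real c"]
        tendsto_divide[OF tendsto_nt_diff tendsto_const, of "- complex_of_real c" x]
      by simp
    moreover have "cond_C1_tilde (Some f) x \<or> cond_C2_tilde (Some f) x"
      using res True by (auto simp: cond_C1_tilde_def cond_C2_tilde_def)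
    ultimately have "asymptotics f 1 x c 0 (\<lambda>_. - c) 1 0 \<and>
        ((cond_C1_tilde (Some f) x \<or> cond_C2_tilde (Some f) x \<or> cond_C3_tilde (Some f) x p c)
          \<longleftrightarrow> 0 < 1 + 0 * p)" by auto
    then show ?thesis by blast
  next
    case False
    then have m0: "m > 0" using m(1) by simp
    have ne: "eventually (\<lambda>z. (z - x) * f z \<noteq> 0) (nt x)"
      using m(2) m0 by (intro tendsto_imp_eventually_ne) auto
    have inv: "((\<lambda>z. inverse ((z - x) * f z)) \<longlongrightarrow> inverse (- complex_of_real m)) (nt x)"
      using m(2) m0 by (intro tendsto_inverse) auto
    have asy: "asymptotics f 1 x c 0 (\<lambda>z. (z - x) * f z / c) (c\<^sup>2 / m) 1"
      unfolding asymptotics_def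
    proof (intro conjI)
      show "eventually (\<lambda>z. (z - x) * f z / c \<noteq> 0) (nt x)"
        using ne by eventually_elim (use c in simp)
      have "((\<lambda>z. - c\<^sup>2 * inverse ((z - x) * f z)) \<longlongrightarrow> complex_of_real (- c\<^sup>2) * inverse (- complex_of_real m)) (nt x)"
        by (intro tendsto_intros inv)
      then show "((\<lambda>z. (complex_of_real 0 * f z - c * complex_of_real 1) / ((z - x) * f z / c)) \<longlongrightarrow> complex_of_real (c\<^sup>2 / m)) (nt x)"
        by (simp add: field_simps power2_eq_square)
      have "eventually (\<lambda>z. complex_of_real c = (z - x) * f z / ((z - x) * f z / c)) (nt x)"
        using ne by eventually_elim (use c in simp)
      then show "((\<lambda>z. (z - x) * f z / ((z - x) * f z / c)) \<longlongrightarrow> complex_of_real (1 * c)) (nt x)"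
        by (intro Lim_transform_eventually[OF tendsto_const]) simp
      have "((\<lambda>z. (z - x) * c * inverse ((z - x) * f z)) \<longlongrightarrow> 0 * complex_of_real c * inverse (- complex_of_real m)) (nt x)"
        by (intro tendsto_intros inv tendsto_nt_diff)
      then show "((\<lambda>z. (z - x) * complex_of_real 1 / ((z - x) * f z / c)) \<longlongrightarrow> complex_of_real (1 * 0)) (nt x)"
        by (simp add: divide_simps mult_ac)
    qed simp
    have "filterlim (\<lambda>z. ((z - x) * f z) / (z - x)) at_infinity (nt x)"
      using m0 eventually_nt_neq[of x] tendsto_nt_diff[of x]
      by (intro filterlim_divide_at_infinity[OF m(2)]) (auto simp: filterlim_at)
    moreover have "eventually (\<lambda>z. ((z - x) * f z) / (z - x) = f z) (nt x)"
      using eventually_nt_neq by eventually_elim simp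
    ultimately have "filterlim f at_infinity (nt x)"
      by (rule filterlim_mono_eventually[OF _ order_refl order_refl])
    then have val: "has_bvalue (Some f) x None" by (simp add: has_bvalue_def has_nt_limit_None)
    have "has_real_inv_bresidue (Some f) x r \<longleftrightarrow> r = - 1 / m" for r
    proof -
      have "1 / - complex_of_real m = complex_of_real (- 1 / m)" by simp
      then show ?thesis
        unfolding has_real_inv_bresidue_def res sphere_inverse_def using m0
        by (auto simp del: of_real_divide of_real_minus)
    qed
    then have "cond_C3_tilde (Some f) x p c \<longleftrightarrow> - p / c\<^sup>2 < 1 / m"
      using val by (simp add: cond_C3_tilde_def) linarith
    moreover have "- p / c\<^sup>2 < 1 / m \<longleftrightarrow> 0 < c\<^sup>2 / m + 1 * p"
    proof -
      have "- p / c\<^sup>2 < 1 / m \<longleftrightarrow> - p < 1 / m * c\<^sup>2" using c by (intro pos_divide_less_eq) simp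
      then show ?thesis by (auto simp: mult.commute)
    qed
    moreover have "\<not> cond_C1_tilde (Some f) x" "\<not> cond_C2_tilde (Some f) x"
      using val res m0 by (auto simp: cond_C1_tilde_def cond_C2_tilde_def)
    ultimately show ?thesis using asy by blast
  qed
qed

lemma param_asymptotics:
  assumes "\<phi> \<in> ext_nevanlinna" "c \<noteq> 0 \<or> e \<noteq> 0"
  obtains \<rho> p0 q0 where "asymptotics (fst (param_pair \<phi>)) (snd (param_pair \<phi>)) x c e \<rho> p0 q0"
    "(if e \<noteq> 0
      then cond_C1 \<phi> x (c / e) \<or> cond_C2 \<phi> x (c / e) \<or> cond_C3 \<phi> x (c / e) p e
      else cond_C1_tilde \<phi> x \<or> cond_C2_tilde \<phi> x \<or> cond_C3_tilde \<phi> x p c) \<longleftrightarrow> 0 < p0 + q0 * p"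
proof (cases \<phi>)
  case (Some f)
  then have "f \<in> nevanlinna" using assms by (auto simp: ext_nevanlinna_def)
  then show thesis
    using that Some assms(2) asymptotics_regular[of f e x c p] asymptotics_singular[of f c x p]
    by (cases "e = 0") auto
next
  case None
  show thesis
  proof (cases "e = 0")
    case False
    have "asymptotics (\<lambda>_. 1) 0 x c e (\<lambda>_. e) 1 0"
      unfolding asymptotics_def using False
        tendsto_divide[OF tendsto_nt_diff tendsto_const, of "complex_of_real e" x] by simp
    moreover have "cond_C1 None x (c / e)" by (auto simp: cond_C1_def has_bvalue_def)
    ultimately show thesis using that[of "\<lambda>_. e" 1 0] None False by simp
  next
    case True
    then have c: "c \<noteq> 0" using assms by simp
    \<comment> \<open>Here \<open>e * f - c * k\<close> vanishes identically, so
      \<open>p0 = 0\<close>. The residue of the parameter is infinite with reciprocal 0, and the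
      sign of \<open>p\<close> alone decides.\<close>
    have "asymptotics (\<lambda>_. 1) 0 x c e (\<lambda>z. (z - x) / c) 0 1"
      unfolding asymptotics_def
    proof (intro conjI)
      show "eventually (\<lambda>z. (z - complex_of_real x) / c \<noteq> 0) (nt x)"
        using eventually_nt_neq by eventually_elim (use c in simp)
      have "eventually (\<lambda>z. complex_of_real c = (z - x) * 1 / ((z - x) / c)) (nt x)"
        using eventually_nt_neq by eventually_elim (use c in simp)
      then show "((\<lambda>z. (z - x) * 1 / ((z - x) / c)) \<longlongrightarrow> complex_of_real (1 * c)) (nt x)"
        by (intro Lim_transform_eventually[OF tendsto_const]) simp
    qed (use True in simp_all)
    moreover have "has_real_inv_bresidue None x r \<longleftrightarrow> r = 0" for r
      by (auto simp: has_real_inv_bresidue_def has_bresidue_def sphere_inverse_def)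
    then have "cond_C3_tilde None x p c \<longleftrightarrow> - p / c\<^sup>2 < 0"
      by (simp add: cond_C3_tilde_def has_bvalue_def)
    then have "cond_C3_tilde None x p c \<longleftrightarrow> 0 < p" using c by (simp add: zero_less_divide_iff)
    moreover have "\<not> cond_C1_tilde None x" "\<not> cond_C2_tilde None x"
      by (auto simp: cond_C1_tilde_def cond_C2_tilde_def has_bvalue_def has_bresidue_def)
    ultimately show thesis using that[of "\<lambda>z. (z - x) / c" 0 1] None True by simp
  qed
qed

subsection \<open>The interpolation conditions in terms of asymptotic data\<close>

text \<open>A finite subset of the open half plane keeps a positive distance from a real
  point.\<close>

lemma eventually_nt_notin_finite:
  assumes "finite S" "S \<subseteq> upper_half_plane"
  shows "eventually (\<lambda>z. z \<notin> S) (nt x)"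
proof -
  have "complex_of_real x \<in> - S" using assms(2) by (auto simp: upper_half_plane_def)
  moreover have "open (- S)" using assms(1) by (intro open_Compl finite_imp_closed)
  ultimately have "eventually (\<lambda>z. z \<in> - S) (at (complex_of_real x))" by (intro eventually_at_in_open')
  then show ?thesis using nt_le_at[of x] by (auto elim: filter_leD)
qed

lemma eventually_nonzero_if_finite_zeros:
  assumes "(\<forall>z\<in>upper_half_plane. V z = 0) \<or> finite {z \<in> upper_half_plane. V z = 0}"
    and "\<not> (\<forall>z\<in>upper_half_plane. V z = (0::complex))"
  shows "eventually (\<lambda>z. V z \<noteq> 0) (nt x)"
proof -
  have "eventually (\<lambda>z. z \<notin> {z \<in> upper_half_plane. V z = 0}) (nt x)"
    using assms by (intro eventually_nt_notin_finite) auto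
  with eventually_nt_upper show ?thesis by eventually_elim auto
qed

lemma quotient_fun_Some:
  assumes "eventually (\<lambda>z. V z \<noteq> 0) (nt x)"
  shows "quotient_fun U V = Some (\<lambda>z. U z / V z)"
proof -
  have "\<not> (\<forall>z\<in>upper_half_plane. V z = 0)"
  proof
    assume "\<forall>z\<in>upper_half_plane. V z = 0"
    with eventually_nt_upper[of x] have "eventually (\<lambda>z. V z = 0) (nt x)" by (auto elim: eventually_mono)
    with assms have "eventually (\<lambda>_. False) (nt x)" by eventually_elim simp
    then show False using nt_neq_bot[of x] by (simp add: trivial_limit_def)
  qed
  then show ?thesis by (simp add: quotient_fun_def)
qed

text \<open>Dividing the two limits, the difference quotient of \<open>W\<close> tends to
  \<open>\<gamma> - q0 / K\<close> if \<open>K \<noteq> 0\<close>, and so does the derivative. It is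
  at most \<open>\<gamma>\<close> iff \<open>q0 / K \<ge> 0\<close>, where \<open>q0 = 0\<close>
  forces \<open>K = 1\<close>.\<close>

lemma regular_condition_iff:
  fixes U V :: "complex \<Rightarrow> complex" and x w \<gamma> K q0 :: real
  assumes holo: "U holomorphic_on upper_half_plane" "V holomorphic_on upper_half_plane"
    and fin: "(\<forall>z\<in>upper_half_plane. V z = 0) \<or> finite {z \<in> upper_half_plane. V z = 0}"
    and \<rho>: "eventually (\<lambda>z. \<rho> z \<noteq> 0) (nt x)"
    and V: "((\<lambda>z. (z - x) * V z / \<rho> z) \<longlongrightarrow> complex_of_real K) (nt x)"
    and U: "((\<lambda>z. (U z - w * V z) / \<rho> z) \<longlongrightarrow> complex_of_real (\<gamma> * K - q0)) (nt x)"
    and q0: "q0 = 0 \<and> K = 1 \<or> q0 = 1"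
  shows "regular_condition (quotient_fun U V) x w \<gamma> \<longleftrightarrow> 0 < K"
proof -
  define W where "W = (\<lambda>z. U z / V z)"
  have quot: "eventually (\<lambda>z. ((U z - w * V z) / \<rho> z) / ((z - x) * V z / \<rho> z) = (W z - w) / (z - x)) (nt x)"
    if "eventually (\<lambda>z. V z \<noteq> 0) (nt x)"
    using that \<rho> eventually_nt_neq by eventually_elim (simp add: W_def field_simps)
  have diff: "eventually (\<lambda>z. W field_differentiable at z) (nt x)" if "eventually (\<lambda>z. V z \<noteq> 0) (nt x)"
    using that holomorphic_eventually_nt[OF holo(1)] holomorphic_eventually_nt[OF holo(2)]
    unfolding W_def by eventually_elim (rule field_differentiable_divide)
  show ?thesis
  proof (cases "K = 0")
    case False
    have "eventually (\<lambda>z. (z - x) * V z / \<rho> z \<noteq> 0) (nt x)"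
      using False by (intro tendsto_imp_eventually_ne[OF V]) simp
    then have nz: "eventually (\<lambda>z. V z \<noteq> 0) (nt x)" by eventually_elim auto
    have "((\<lambda>z. (W z - w) / (z - x)) \<longlongrightarrow> complex_of_real (\<gamma> * K - q0) / complex_of_real K) (nt x)"
      using False by (intro Lim_transform_eventually[OF tendsto_divide[OF U V] quot[OF nz]]) simp
    then have lim: "((\<lambda>z. (W z - w) / (z - x)) \<longlongrightarrow> complex_of_real (\<gamma> - q0 / K)) (nt x)"
      using False by (simp add: diff_divide_distrib)
    have "(W \<longlongrightarrow> complex_of_real w) (nt x)" by (rule bvalue_if_quotient[OF lim])
    moreover have "(deriv W \<longlongrightarrow> complex_of_real (\<gamma> - q0 / K)) (nt x)"
      by (rule deriv_tendsto_nt[OF diff[OF nz] lim])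
    then have "has_bderiv (Some W) x (complex_of_real d) \<longleftrightarrow> d = \<gamma> - q0 / K" for d
      using has_nt_limit_unique[of "deriv W" x "Some (complex_of_real d)" "Some (complex_of_real (\<gamma> - q0 / K))"]
      by (auto simp: has_bderiv_def has_nt_limit_Some simp del: of_real_diff of_real_divide)
    ultimately have "regular_condition (Some W) x w \<gamma> \<longleftrightarrow> \<gamma> - q0 / K \<le> \<gamma>"
      by (simp add: regular_condition_def has_bvalue_def has_nt_limit_Some)
    also have "\<dots> \<longleftrightarrow> 0 < K" using q0 False by (auto simp: zero_le_divide_iff)
    finally show ?thesis unfolding quotient_fun_Some[OF nz] W_def .
  next
    case True
    \<comment> \<open>The numerator of the quotient now tends to \<open>- 1\<close> and the
      denominator to 0, so the quotient blows up. If \<open>V\<close> vanishes identically,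
      \<open>W\<close> is infinite and has no finite value.\<close>
    then have [simp]: "q0 = 1" using q0 by simp
    have "\<not> regular_condition (quotient_fun U V) x w \<gamma>"
    proof (cases "\<forall>z\<in>upper_half_plane. V z = 0")
      case True
      then show ?thesis by (simp add: quotient_fun_def regular_condition_def has_bvalue_def)
    next
      case False
      have nz: "eventually (\<lambda>z. V z \<noteq> 0) (nt x)"
        by (rule eventually_nonzero_if_finite_zeros[OF fin False])
      have "eventually (\<lambda>z. (z - x) * V z / \<rho> z \<noteq> 0) (nt x)"
        using nz \<rho> eventually_nt_neq by eventually_elim simp
      then have "filterlim (\<lambda>z. (z - x) * V z / \<rho> z) (at 0) (nt x)"
        using V True by (simp add: filterlim_at)
      then have "filterlim (\<lambda>z. ((U z - w * V z) / \<rho> z) / ((z - x) * V z / \<rho> z)) at_infinity (nt x)"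
        using True by (intro filterlim_divide_at_infinity[OF U]) auto
      then have "filterlim (\<lambda>z. (W z - w) / (z - x)) at_infinity (nt x)"
        using filterlim_cong[OF refl refl quot[OF nz], of at_infinity] by simp
      then have "\<not> ((W \<longlongrightarrow> complex_of_real w) (nt x) \<and> (deriv W \<longlongrightarrow> complex_of_real d) (nt x))" for d
        using bdd_quotient_if_deriv_tendsto[OF diff[OF nz]] by blast
      then show ?thesis
        unfolding quotient_fun_Some[OF nz] W_def[symmetric]
        by (auto simp: regular_condition_def has_bvalue_def has_bderiv_def has_nt_limit_Some)
    qed
    then show ?thesis using True by simp
  qed
qed

text \<open>The finiteness of the zeros of \<open>V\<close> is essential here: division by zero yields 0, so that zeros
  accumulating at \<open>x\<close> would spoil an infinite limit of \<open>(z - x) W(z)\<close>.\<close>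

lemma singular_condition_iff:
  fixes U V :: "complex \<Rightarrow> complex" and x \<xi> K q0 :: real
  assumes fin: "(\<forall>z\<in>upper_half_plane. V z = 0) \<or> finite {z \<in> upper_half_plane. V z = 0}"
    and \<rho>: "eventually (\<lambda>z. \<rho> z \<noteq> 0) (nt x)" and \<xi>: "\<xi> \<noteq> 0"
    and U: "((\<lambda>z. (z - x) * U z / \<rho> z) \<longlongrightarrow> complex_of_real (\<xi> * K)) (nt x)"
    and V: "((\<lambda>z. V z / \<rho> z) \<longlongrightarrow> complex_of_real (K + q0 / \<xi>)) (nt x)"
    and q0: "q0 = 0 \<and> K = 1 \<or> q0 = 1"
  shows "singular_condition (quotient_fun U V) x \<xi> \<longleftrightarrow> 0 < K"
proof -
  define W where "W = (\<lambda>z. U z / V z)"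
  have quot: "eventually (\<lambda>z. ((z - x) * U z / \<rho> z) / (V z / \<rho> z) = (z - x) * W z) (nt x)"
    if "eventually (\<lambda>z. V z \<noteq> 0) (nt x)"
    using that \<rho> by eventually_elim (simp add: W_def field_simps)
  show ?thesis
  proof (cases "K + q0 / \<xi> = 0")
    case False
    \<comment> \<open>\<open>a\<close> is the limit of \<open>(z - x) * W z\<close>. For
      \<open>K \<noteq> 0\<close> its reciprocal exceeds \<open>1 / \<xi>\<close> by
      \<open>q0 / (\<xi>\<^sup>2 * K)\<close>; for \<open>K = 0\<close> it is 0, its reciprocal is
      infinite and the condition fails.\<close>
    define a where "a = \<xi> * K / (K + q0 / \<xi>)"
    have "eventually (\<lambda>z. V z / \<rho> z \<noteq> 0) (nt x)"
      using False by (intro tendsto_imp_eventually_ne[OF V]) (simp del: of_real_add of_real_divide)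
    then have nz: "eventually (\<lambda>z. V z \<noteq> 0) (nt x)" by eventually_elim auto
    have "((\<lambda>z. (z - x) * W z) \<longlongrightarrow> complex_of_real (\<xi> * K) / complex_of_real (K + q0 / \<xi>)) (nt x)"
      using False by (intro Lim_transform_eventually[OF tendsto_divide[OF U V] quot[OF nz]])
        (simp del: of_real_add of_real_divide)
    then have "((\<lambda>z. (z - x) * W z) \<longlongrightarrow> complex_of_real a) (nt x)"
      by (simp add: a_def)
    then have "has_bresidue (Some W) x v \<longleftrightarrow> v = Some (complex_of_real a)" for v
      unfolding has_bresidue_def using has_nt_limit_unique by (auto simp: has_nt_limit_Some[symmetric])
    moreover have "complex_of_real 1 / complex_of_real a = complex_of_real r \<longleftrightarrow> r = 1 / a" for r
      by (metis of_real_divide of_real_eq_iff)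
    ultimately have "has_real_inv_bresidue (Some W) x r \<longleftrightarrow> a \<noteq> 0 \<and> r = 1 / a" for r
      unfolding has_real_inv_bresidue_def sphere_inverse_def by simp
    then have "singular_condition (Some W) x \<xi> \<longleftrightarrow> a \<noteq> 0 \<and> 1 / \<xi> \<le> 1 / a"
      by (auto simp: singular_condition_def)
    also have "\<dots> \<longleftrightarrow> 0 < K"
    proof (cases "K = 0")
      case True
      then show ?thesis by (simp add: a_def)
    next
      case Kn: False
      have "1 / a = 1 / \<xi> + q0 / (\<xi>\<^sup>2 * K)"
        using Kn \<xi> False by (simp add: a_def power2_eq_square divide_simps)
      then show ?thesis using q0 Kn \<xi> False by (auto simp: a_def zero_le_divide_iff zero_le_mult_iff)
    qed
    finally show ?thesis unfolding quotient_fun_Some[OF nz] W_def .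
  next
    case True
    then have q[simp]: "q0 = 1" using q0 by auto
    \<comment> \<open>Here the residue of \<open>W\<close> is infinite with reciprocal 0, so the
      condition reads \<open>1 / \<xi> \<le> 0\<close>, which is the sign condition on this
      \<open>K\<close>.\<close>
    have K: "K = - 1 / \<xi>" using True by simp
    have "has_bresidue (quotient_fun U V) x v \<longleftrightarrow> v = None" for v
    proof (cases "\<forall>z\<in>upper_half_plane. V z = 0")
      case True
      then show ?thesis by (simp add: quotient_fun_def has_bresidue_def)
    next
      case False
      have nz: "eventually (\<lambda>z. V z \<noteq> 0) (nt x)"
        by (rule eventually_nonzero_if_finite_zeros[OF fin False])
      have "eventually (\<lambda>z. V z / \<rho> z \<noteq> 0) (nt x)"
        using nz \<rho> by eventually_elim simp
      then have "filterlim (\<lambda>z. V z / \<rho> z) (at 0) (nt x)"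
        using V unfolding True by (simp add: filterlim_at)
      then have "filterlim (\<lambda>z. ((z - x) * U z / \<rho> z) / (V z / \<rho> z)) at_infinity (nt x)"
        using K \<xi> by (intro filterlim_divide_at_infinity[OF U]) auto
      then have "filterlim (\<lambda>z. (z - x) * W z) at_infinity (nt x)"
        using filterlim_cong[OF refl refl quot[OF nz], of at_infinity] by simp
      then show ?thesis
        unfolding quotient_fun_Some[OF nz] W_def[symmetric] has_bresidue_def
        using has_nt_limit_unique by (auto simp: has_nt_limit_None[symmetric])
    qed
    then have "has_real_inv_bresidue (quotient_fun U V) x r \<longleftrightarrow> r = 0" for r
      by (auto simp: has_real_inv_bresidue_def sphere_inverse_def)
    then have "singular_condition (quotient_fun U V) x \<xi> \<longleftrightarrow> 1 / \<xi> \<le> 0"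
      by (simp add: singular_condition_def)
    also have "\<dots> \<longleftrightarrow> 0 < K" unfolding K using \<xi> by (auto simp: divide_le_0_iff zero_less_divide_iff)
    finally show ?thesis .
  qed
qed

subsection \<open>The Stein equation of the Pick matrix\<close>

lemma combine_fractions:
  fixes a b f k r s t g :: "'a::field"
  shows "g * ((s * (a * f / r) - t * (a * k / r)) / b) = g * (a * (s * f - t * k) / b) / r"
proof -
  have "s * (a * f / r) - t * (a * k / r) = a * (s * f - t * k) / r"
    by (simp add: diff_divide_distrib right_diff_distrib mult_ac)
  then show ?thesis by simp
qed

text \<open>The Pick matrix \<open>p\<close> and its inverse \<open>q\<close> enter only through
  symmetry and the displacement equation \<open>P X - X P = E\<^sup>T C - C\<^sup>T E\<close>, so
  regular and singular nodes need not be distinguished.\<close>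

locale stein_data =
  fixes n :: nat and x c e :: "nat \<Rightarrow> real" and p q :: "nat \<Rightarrow> nat \<Rightarrow> real"
  assumes p_sym: "i < n \<Longrightarrow> j < n \<Longrightarrow> p i j = p j i"
    and q_sym: "i < n \<Longrightarrow> j < n \<Longrightarrow> q i j = q j i"
    and pq: "i < n \<Longrightarrow> j < n \<Longrightarrow> (\<Sum>k<n. p i k * q k j) = (if i = j then 1 else 0)"
    and stein: "i < n \<Longrightarrow> j < n \<Longrightarrow> p i j * (x j - x i) = e i * c j - c i * e j"
    and inj_x: "inj_on x {..<n}"
begin

definition ct :: "nat \<Rightarrow> real" where "ct i = (\<Sum>k<n. c k * q k i)"
definition et :: "nat \<Rightarrow> real" where "et i = (\<Sum>k<n. e k * q k i)"

lemma qp: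
  assumes "i < n" "j < n"
  shows "(\<Sum>k<n. q i k * p k j) = (if i = j then 1 else 0)"
proof -
  have "(\<Sum>k<n. q i k * p k j) = (\<Sum>k<n. p j k * q k i)"
  proof (intro sum.cong refl)
    fix k assume "k \<in> {..<n}"
    then have "q i k = q k i" "p k j = p j k" using assms by (auto intro: p_sym q_sym)
    then show "q i k * p k j = p j k * q k i" by simp
  qed
  then show ?thesis using pq[OF assms(2,1)] by auto
qed

lemma sum_delta_mult: "i < n \<Longrightarrow> (\<Sum>k<n. (if i = k then 1 else 0) * a k) = (a i :: real)"
  "i < n \<Longrightarrow> (\<Sum>k<n. a k * (if k = i then 1 else 0)) = (a i :: real)"
proof -
  assume i: "i < n"
  have "(\<Sum>k<n. (if i = k then 1 else 0) * a k) = (\<Sum>k<n. if i = k then a k else 0)"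
    by (intro sum.cong) auto
  then show "(\<Sum>k<n. (if i = k then 1 else 0) * a k) = a i" using i by simp
  have "(\<Sum>k<n. a k * (if k = i then 1 else 0)) = (\<Sum>k<n. if k = i then a k else 0)"
    by (intro sum.cong) auto
  then show "(\<Sum>k<n. a k * (if k = i then 1 else 0)) = a i" using i by simp
qed

lemma p_mult_q_sum:
  assumes "i < n"
  shows "(\<Sum>j<n. p i j * (\<Sum>k<n. a k * q k j)) = a i"
proof -
  have "(\<Sum>j<n. p i j * (\<Sum>k<n. a k * q k j)) = (\<Sum>j<n. \<Sum>k<n. a k * (p i j * q j k))"
    unfolding sum_distrib_left
  proof (intro sum.cong refl)
    fix j k assume "j \<in> {..<n}" "k \<in> {..<n}"
    then have "q j k = q k j" by (intro q_sym) auto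
    then show "p i j * (a k * q k j) = a k * (p i j * q j k)" by simp
  qed
  also have "\<dots> = (\<Sum>k<n. \<Sum>j<n. a k * (p i j * q j k))" by (rule sum.swap)
  also have "\<dots> = (\<Sum>k<n. (if i = k then 1 else 0) * a k)"
    using assms by (intro sum.cong) (auto simp: sum_distrib_left[symmetric] pq)
  also have "\<dots> = a i" by (rule sum_delta_mult(1)[OF assms])
  finally show ?thesis .
qed

lemma p_ct: "i < n \<Longrightarrow> (\<Sum>j<n. p i j * ct j) = c i"
  and p_et: "i < n \<Longrightarrow> (\<Sum>j<n. p i j * et j) = e i"
  unfolding ct_def et_def by (rule p_mult_q_sum; assumption)+

text \<open>The Stein equation is multiplied by the inverse \<open>Q\<close> of \<open>P\<close>
  from both sides: \<open>Q (P X - X P) Q = X Q - Q X\<close>. This flips the sign of the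
  commutator.\<close>

lemma stein_inverse:
  assumes i: "i < n" and j: "j < n"
  shows "q i j * (x i - x j) = et i * ct j - ct i * et j"
proof -
  have "(\<Sum>k<n. \<Sum>m<n. q i k * (p k m * (x m - x k)) * q m j)
      = (\<Sum>k<n. \<Sum>m<n. q i k * p k m * (x m * q m j)) - (\<Sum>k<n. \<Sum>m<n. q i k * x k * (p k m * q m j))"
    by (simp add: sum_subtractf[symmetric] algebra_simps)
  also have "(\<Sum>k<n. \<Sum>m<n. q i k * p k m * (x m * q m j)) = (\<Sum>m<n. \<Sum>k<n. q i k * p k m * (x m * q m j))"
    by (rule sum.swap)
  also have "\<dots> = (\<Sum>m<n. (if i = m then 1 else 0) * (x m * q m j))"
    using i by (intro sum.cong) (auto simp: sum_distrib_right[symmetric] qp)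
  also have "\<dots> = x i * q i j" by (rule sum_delta_mult(1)[OF i])
  also have "(\<Sum>k<n. \<Sum>m<n. q i k * x k * (p k m * q m j)) = (\<Sum>k<n. (q i k * x k) * (if k = j then 1 else 0))"
    using j by (intro sum.cong) (auto simp: sum_distrib_left[symmetric] pq)
  also have "\<dots> = q i j * x j" by (rule sum_delta_mult(2)[OF j])
  finally have l: "(\<Sum>k<n. \<Sum>m<n. q i k * (p k m * (x m - x k)) * q m j) = x i * q i j - q i j * x j" .
  have "(\<Sum>k<n. \<Sum>m<n. q i k * (p k m * (x m - x k)) * q m j)
      = (\<Sum>k<n. \<Sum>m<n. (e k * q k i) * (c m * q m j)) - (\<Sum>k<n. \<Sum>m<n. (c k * q k i) * (e m * q m j))"
    unfolding sum_subtractf[symmetric]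
  proof (intro sum.cong refl)
    fix k m assume "k \<in> {..<n}" "m \<in> {..<n}"
    then show "q i k * (p k m * (x m - x k)) * q m j = e k * q k i * (c m * q m j) - c k * q k i * (e m * q m j)"
      using q_sym[OF i, of k] by (simp add: stein) (simp add: algebra_simps)
  qed
  also have "\<dots> = et i * ct j - ct i * et j"
    unfolding ct_def et_def sum_product ..
  finally show ?thesis unfolding l by (simp add: algebra_simps)
qed

text \<open>If both entries vanished, the inverse Stein equation and the distinctness of the nodes
  would make row \<open>i\<close> of \<open>q\<close> zero off the diagonal. Then
  \<open>ct i = c i * q i i\<close> and \<open>et i = e i * q i i\<close>, so the diagonal entry
  would vanish as well, which is impossible in an invertible matrix.\<close>

lemma tilde_nonzero:
  assumes i: "i < n" and nz: "c i \<noteq> 0 \<or> e i \<noteq> 0"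
  shows "ct i \<noteq> 0 \<or> et i \<noteq> 0"
proof (rule ccontr)
  assume "\<not> ?thesis"
  then have z: "ct i = 0" "et i = 0" by auto
  have q0: "q i j = 0" if "j < n" "j \<noteq> i" for j
    using stein_inverse[OF i that(1)] z inj_onD[OF inj_x, of i j] that i by auto
  have s: "(\<Sum>k<n. a k * q k i) = a i * q i i" for a :: "nat \<Rightarrow> real"
  proof -
    have "(\<Sum>k<n. a k * q k i) = (\<Sum>k<n. if k = i then a k * q k i else 0)"
    proof (intro sum.cong refl)
      fix k assume "k \<in> {..<n}"
      then show "a k * q k i = (if k = i then a k * q k i else 0)"
        using q0[of k] q_sym[OF i, of k] by simp
    qed
    then show ?thesis using i by simp
  qed
  have "c i * q i i = 0" "e i * q i i = 0" using z unfolding ct_def et_def s by auto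
  then have "q i i = 0" using nz by auto
  then show False using pq[OF i i] s[of "p i"] by simp
qed

text \<open>\<open>U\<close> and \<open>V\<close> are the numerator and the denominator of \<open>T\<^sub>\<Theta>[f / k]\<close>.\<close>

context
  fixes f :: "complex \<Rightarrow> complex" and k :: real
begin

definition u :: "nat \<Rightarrow> complex \<Rightarrow> complex" where
  "u j z = et j * f z - ct j * complex_of_real k"

definition U :: "complex \<Rightarrow> complex" where
  "U z = f z + (\<Sum>j<n. c j * u j z / (z - complex_of_real (x j)))"

definition V :: "complex \<Rightarrow> complex" where
  "V z = k + (\<Sum>j<n. e j * u j z / (z - complex_of_real (x j)))"

text \<open>As \<open>P\<close> maps \<open>et\<close> and \<open>ct\<close> back to
  \<open>e\<close> and \<open>c\<close>, the part outside the sums is the sum of the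
  \<open>p i j * u j z\<close>. The Stein equation rewrites the rest, and
  \<open>1 + (x j - x i) / (z - x j)\<close> equals \<open>(z - x i) / (z - x j)\<close>.\<close>

lemma node_identity:
  assumes i: "i < n" and z: "z \<in> upper_half_plane"
  shows "e i * U z - c i * V z = (\<Sum>j<n. p i j * ((z - complex_of_real (x i)) * u j z / (z - complex_of_real (x j))))"
proof -
  have ne: "z - complex_of_real (x j) \<noteq> 0" for j
    using z by (auto simp: upper_half_plane_def complex_eq_iff)
  have pu: "(\<Sum>j<n. p i j * u j z) = e i * f z - c i * complex_of_real k"
  proof -
    have "(\<Sum>j<n. p i j * u j z) = complex_of_real (\<Sum>j<n. p i j * et j) * f z - complex_of_real (\<Sum>j<n. p i j * ct j) * k"
      by (simp add: u_def sum_subtractf sum_distrib_left sum_distrib_right algebra_simps)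
    then show ?thesis by (simp only: p_ct[OF i] p_et[OF i])
  qed
  have "e i * U z - c i * V z = (e i * f z - c i * complex_of_real k) + (\<Sum>j<n. complex_of_real (e i * c j - c i * e j) * (u j z / (z - complex_of_real (x j))))"
  proof -
    have "complex_of_real (e i * c j - c i * e j) * (u j z / (z - complex_of_real (x j)))
        = e i * (c j * u j z / (z - complex_of_real (x j))) - c i * (e j * u j z / (z - complex_of_real (x j)))" for j
      by (simp add: left_diff_distrib diff_divide_distrib mult.assoc)
    then show ?thesis
      by (simp only: U_def V_def sum_subtractf sum_distrib_left[symmetric]) (simp add: algebra_simps)
  qed
  also have "\<dots> = (\<Sum>j<n. p i j * u j z) + (\<Sum>j<n. complex_of_real (p i j * (x j - x i)) * (u j z / (z - complex_of_real (x j))))"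
    using i by (simp add: pu stein)
  also have "\<dots> = (\<Sum>j<n. p i j * ((z - complex_of_real (x i)) * u j z / (z - complex_of_real (x j))))"
    unfolding sum.distrib[symmetric]
  proof (intro sum.cong refl)
    fix j
    have "P * v + P * (b - a) * (v / (z - b)) = P * ((z - a) * v / (z - b))" if "z - b \<noteq> 0" for P v a b :: complex
      using that by (simp add: field_simps)
    from this[OF ne[of j], of "p i j" "u j z" "x i"]
    show "p i j * u j z + complex_of_real (p i j * (x j - x i)) * (u j z / (z - complex_of_real (x j)))
        = p i j * ((z - complex_of_real (x i)) * u j z / (z - complex_of_real (x j)))"
      by simp
  qed
  finally show ?thesis .
qed

text \<open>In the summand \<open>j = i\<close> the two linear factors cancel, which leaves
  \<open>g i * p0\<close>. For \<open>j \<noteq> i\<close> the limit contains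
  \<open>et j * ct i - ct j * et i\<close>, which the inverse Stein equation reduces to
  \<open>- q j i\<close> after division by \<open>x i - x j\<close>. The weights \<open>g\<close>
  will be \<open>c\<close>, \<open>e\<close> and row \<open>i\<close> of \<open>p\<close>.\<close>

lemma node_sum_tendsto:
  assumes i: "i < n" and asy: "asymptotics f k (x i) (ct i) (et i) \<rho> p0 q0"
  shows "((\<lambda>z. (\<Sum>j<n. g j * ((z - complex_of_real (x i)) * u j z / (z - complex_of_real (x j)))) / \<rho> z) \<longlongrightarrow>
      complex_of_real (g i * p0 - q0 * (\<Sum>j\<in>{..<n} - {i}. g j * q j i))) (nt (x i))"
proof -
  have f': "((\<lambda>z. (z - complex_of_real (x i)) * f z / \<rho> z) \<longlongrightarrow> complex_of_real (q0 * ct i)) (nt (x i))"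
    and k': "((\<lambda>z. (z - complex_of_real (x i)) * k / \<rho> z) \<longlongrightarrow> complex_of_real (q0 * et i)) (nt (x i))"
    and u': "((\<lambda>z. u i z / \<rho> z) \<longlongrightarrow> complex_of_real p0) (nt (x i))"
    using asy unfolding asymptotics_def u_def by blast+
  have lim: "((\<lambda>z. g j * ((et j * ((z - complex_of_real (x i)) * f z / \<rho> z) - ct j * ((z - complex_of_real (x i)) * k / \<rho> z)) / (z - complex_of_real (x j)))) \<longlongrightarrow>
      g j * ((et j * complex_of_real (q0 * ct i) - ct j * complex_of_real (q0 * et i)) / (x i - x j))) (nt (x i))"
    if "j \<in> {..<n} - {i}" for j
    using that inj_onD[OF inj_x, of i j] i
      tendsto_diff[OF tendsto_nt tendsto_const, of "x j" "x i"]
    by (intro tendsto_intros f' k') auto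
  have val: "g j * ((et j * complex_of_real (q0 * ct i) - ct j * complex_of_real (q0 * et i)) / (x i - x j))
      = complex_of_real (- q0 * (g j * q j i))" if "j \<in> {..<n} - {i}" for j
  proof -
    have ne: "x i - x j \<noteq> 0" using that inj_onD[OF inj_x, of i j] i by auto
    have "g j * ((et j * (q0 * ct i) - ct j * (q0 * et i)) / (x i - x j)) = g j * (- q0 * (q i j * (x i - x j)) / (x i - x j))"
    proof -
      have j: "j < n" using that by simp
      have "et j * (q0 * ct i) - ct j * (q0 * et i) = - q0 * (q i j * (x i - x j))"
        unfolding stein_inverse[OF i j] by (simp add: algebra_simps)
      then show ?thesis by simp
    qed
    also have "\<dots> = - q0 * (g j * q j i)" using ne q_sym[OF i, of j] that by simp
    finally show ?thesis by (metis of_real_diff of_real_divide of_real_mult)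
  qed
  have "((\<lambda>z. g i * (u i z / \<rho> z) + (\<Sum>j\<in>{..<n} - {i}.
        g j * ((et j * ((z - complex_of_real (x i)) * f z / \<rho> z) - ct j * ((z - complex_of_real (x i)) * k / \<rho> z)) / (z - complex_of_real (x j))))) \<longlongrightarrow>
      g i * complex_of_real p0 + (\<Sum>j\<in>{..<n} - {i}. complex_of_real (- q0 * (g j * q j i)))) (nt (x i))"
    using lim val by (intro tendsto_intros u' tendsto_sum) simp
  moreover have "eventually (\<lambda>z. g i * (u i z / \<rho> z) + (\<Sum>j\<in>{..<n} - {i}.
        g j * ((et j * ((z - complex_of_real (x i)) * f z / \<rho> z) - ct j * ((z - complex_of_real (x i)) * k / \<rho> z)) / (z - complex_of_real (x j))))
      = (\<Sum>j<n. g j * ((z - complex_of_real (x i)) * u j z / (z - complex_of_real (x j)))) / \<rho> z) (nt (x i))"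
    using eventually_nt_neq
  proof eventually_elim
    case (elim z)
    have "g j * ((et j * ((z - complex_of_real (x i)) * f z / \<rho> z) - ct j * ((z - complex_of_real (x i)) * k / \<rho> z)) / (z - complex_of_real (x j)))
        = g j * ((z - complex_of_real (x i)) * u j z / (z - complex_of_real (x j))) / \<rho> z" for j
      unfolding u_def by (rule combine_fractions)
    then show ?case using i elim
      by (simp add: sum.remove[of "{..<n}" i] add_divide_distrib sum_divide_distrib)
  qed
  ultimately have "((\<lambda>z. (\<Sum>j<n. g j * ((z - complex_of_real (x i)) * u j z / (z - complex_of_real (x j)))) / \<rho> z) \<longlongrightarrow>
      g i * complex_of_real p0 + (\<Sum>j\<in>{..<n} - {i}. complex_of_real (- q0 * (g j * q j i)))) (nt (x i))"
    by (rule Lim_transform_eventually)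
  then show ?thesis by (simp add: sum_distrib_left sum_negf)
qed

text \<open>For the weights \<open>c\<close> and \<open>e\<close>, the full sum \<open>ct i\<close>
  or \<open>et i\<close> cancels the contribution of \<open>f\<close> or \<open>k\<close> outside
  the sum, and \<open>K\<close> remains. For row \<open>i\<close> of \<open>p\<close> the full sum
  is 1, which leaves the extra \<open>- q0\<close>.\<close>

lemma node_limits:
  assumes i: "i < n" and asy: "asymptotics f k (x i) (ct i) (et i) \<rho> p0 q0"
  defines "K \<equiv> p0 + q0 * q i i"
  shows "((\<lambda>z. (z - complex_of_real (x i)) * U z / \<rho> z) \<longlongrightarrow> complex_of_real (c i * K)) (nt (x i))"
    and "((\<lambda>z. (z - complex_of_real (x i)) * V z / \<rho> z) \<longlongrightarrow> complex_of_real (e i * K)) (nt (x i))"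
    and "((\<lambda>z. (e i * U z - c i * V z) / \<rho> z) \<longlongrightarrow> complex_of_real (p i i * K - q0)) (nt (x i))"
proof -
  have split: "(\<Sum>j\<in>{..<n} - {i}. g j * q j i) = (\<Sum>j<n. g j * q j i) - g i * q i i" for g :: "nat \<Rightarrow> real"
    using i by (simp add: sum_diff1)
  have f': "((\<lambda>z. (z - complex_of_real (x i)) * f z / \<rho> z) \<longlongrightarrow> complex_of_real (q0 * ct i)) (nt (x i))"
    and k': "((\<lambda>z. (z - complex_of_real (x i)) * k / \<rho> z) \<longlongrightarrow> complex_of_real (q0 * et i)) (nt (x i))"
    using asy unfolding asymptotics_def by blast+
  have "((\<lambda>z. (z - complex_of_real (x i)) * f z / \<rho> z + (\<Sum>j<n. c j * ((z - complex_of_real (x i)) * u j z / (z - complex_of_real (x j)))) / \<rho> z) \<longlongrightarrow>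
      complex_of_real (q0 * ct i) + complex_of_real (c i * p0 - q0 * (\<Sum>j\<in>{..<n} - {i}. c j * q j i))) (nt (x i))"
    by (intro tendsto_add f' node_sum_tendsto[OF i asy])
  moreover have "complex_of_real (q0 * ct i) + complex_of_real (c i * p0 - q0 * (\<Sum>j\<in>{..<n} - {i}. c j * q j i)) = complex_of_real (c i * K)"
    unfolding split ct_def[symmetric] of_real_add[symmetric] by (simp add: K_def algebra_simps)
  moreover have "(z - complex_of_real (x i)) * f z / \<rho> z + (\<Sum>j<n. c j * ((z - complex_of_real (x i)) * u j z / (z - complex_of_real (x j)))) / \<rho> z = (z - complex_of_real (x i)) * U z / \<rho> z" for z
    by (simp add: U_def distrib_left add_divide_distrib sum_distrib_left mult_ac)
  ultimately show "((\<lambda>z. (z - complex_of_real (x i)) * U z / \<rho> z) \<longlongrightarrow> complex_of_real (c i * K)) (nt (x i))" by (simp only:)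
  have "((\<lambda>z. (z - complex_of_real (x i)) * k / \<rho> z + (\<Sum>j<n. e j * ((z - complex_of_real (x i)) * u j z / (z - complex_of_real (x j)))) / \<rho> z) \<longlongrightarrow>
      complex_of_real (q0 * et i) + complex_of_real (e i * p0 - q0 * (\<Sum>j\<in>{..<n} - {i}. e j * q j i))) (nt (x i))"
    by (intro tendsto_add k' node_sum_tendsto[OF i asy])
  moreover have "complex_of_real (q0 * et i) + complex_of_real (e i * p0 - q0 * (\<Sum>j\<in>{..<n} - {i}. e j * q j i)) = complex_of_real (e i * K)"
    unfolding split et_def[symmetric] of_real_add[symmetric] by (simp add: K_def algebra_simps)
  moreover have "(z - complex_of_real (x i)) * k / \<rho> z + (\<Sum>j<n. e j * ((z - complex_of_real (x i)) * u j z / (z - complex_of_real (x j)))) / \<rho> z = (z - complex_of_real (x i)) * V z / \<rho> z" for z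
    by (simp add: V_def distrib_left add_divide_distrib sum_distrib_left mult_ac)
  ultimately show "((\<lambda>z. (z - complex_of_real (x i)) * V z / \<rho> z) \<longlongrightarrow> complex_of_real (e i * K)) (nt (x i))" by (simp only:)
  have "p i i * p0 - q0 * (\<Sum>j\<in>{..<n} - {i}. p i j * q j i) = p i i * K - q0"
    unfolding split using pq[OF i i] by (simp add: K_def algebra_simps)
  moreover have "eventually (\<lambda>z. (\<Sum>j<n. p i j * ((z - complex_of_real (x i)) * u j z / (z - complex_of_real (x j)))) / \<rho> z = (e i * U z - c i * V z) / \<rho> z) (nt (x i))"
    using eventually_nt_upper by eventually_elim (simp only: node_identity[OF i])
  ultimately show "((\<lambda>z. (e i * U z - c i * V z) / \<rho> z) \<longlongrightarrow> complex_of_real (p i i * K - q0)) (nt (x i))"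
    using Lim_transform_eventually[OF node_sum_tendsto[OF i asy, of "p i"]] by (simp only:)
qed

text \<open>Sorting the terms by the factor \<open>f\<close> exhibits partial fractions with real
  coefficients.\<close>

lemma V_zeros:
  assumes f: "f \<in> nevanlinna"
  shows "(\<forall>z\<in>upper_half_plane. V z = 0) \<or> finite {z \<in> upper_half_plane. V z = 0}"
proof -
  have "V = (\<lambda>z. (complex_of_real 0 + (\<Sum>j<n. complex_of_real (e j * et j) / (z - complex_of_real (x j)))) * f z
      + (complex_of_real k + (\<Sum>j<n. complex_of_real (- e j * ct j * k) / (z - complex_of_real (x j)))))"
  proof
    fix z
    have "e j * u j z / (z - complex_of_real (x j)) = complex_of_real (e j * et j) / (z - complex_of_real (x j)) * f z + complex_of_real (- e j * ct j * k) / (z - complex_of_real (x j))" for j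
      unfolding u_def by (simp add: add_divide_distrib[symmetric] algebra_simps)
    then show "V z = (complex_of_real 0 + (\<Sum>j<n. complex_of_real (e j * et j) / (z - complex_of_real (x j)))) * f z
      + (complex_of_real k + (\<Sum>j<n. complex_of_real (- e j * ct j * k) / (z - complex_of_real (x j))))"
      unfolding V_def by (simp only: sum.distrib sum_distrib_right of_real_0 add_0_left add_ac)
  qed
  then show ?thesis by (simp only:) (rule nevanlinna_partial_fractions_zeros[OF f])
qed

lemma holomorphic_UV:
  assumes f: "f \<in> nevanlinna"
  shows "U holomorphic_on upper_half_plane" "V holomorphic_on upper_half_plane"
proof -
  have ne: "z - complex_of_real (x j) \<noteq> 0" if "z \<in> upper_half_plane" for z j
    using that by (auto simp: upper_half_plane_def complex_eq_iff)
  show "U holomorphic_on upper_half_plane" "V holomorphic_on upper_half_plane"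
    unfolding U_def V_def u_def by (intro holomorphic_intros nevanlinnaD(1)[OF f] ne; assumption)+
qed

end

end

subsection \<open>The matrix function \<open>\<Theta>\<close>\<close>

lemma mult_mat_entry:
  assumes "A \<in> carrier_mat m n" "B \<in> carrier_mat n k" "i < m" "j < k"
  shows "(A * B) $$ (i, j) = (\<Sum>s<n. A $$ (i, s) * B $$ (s, j))"
  using assms by (auto simp: scalar_prod_def atLeast0LessThan intro!: sum.cong)

text \<open>A two-sided inverse guarantees that \<open>mat_inverse\<close> succeeds, and uniqueness
  of inverses identifies its result.\<close>

lemma minv_inverse:
  fixes A :: "'a::field mat"
  assumes A: "A \<in> carrier_mat n n" and B: "B \<in> carrier_mat n n" "A * B = 1\<^sub>m n" "B * A = 1\<^sub>m n"
  shows "minv A = B"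
proof -
  have "A \<in> Units (ring_mat TYPE('a) n ())"
    using assms by (auto simp: Units_def ring_mat_def)
  then obtain C where C: "mat_inverse A = Some C" using mat_inverse(1)[OF A, of "()"] by (cases "mat_inverse A") auto
  then have AC: "A * C = 1\<^sub>m n" and Cc: "C \<in> carrier_mat n n" using mat_inverse(2)[OF A] by auto
  have "C = (B * A) * C" using B Cc by simp
  also have "\<dots> = B * (A * C)" using assoc_mult_mat[OF B(1) A Cc] .
  also have "\<dots> = B" using B by (simp add: AC)
  finally have "C = B" .
  then show ?thesis using C by (simp add: minv_def)
qed

lemma minv_invertible:
  fixes A :: "'a::field mat"
  assumes A: "A \<in> carrier_mat n n" and inv: "invertible_mat A"
  shows "minv A \<in> carrier_mat n n" "A * minv A = 1\<^sub>m n" "minv A * A = 1\<^sub>m n"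
proof -
  obtain B where B: "A * B = 1\<^sub>m n" "B * A = 1\<^sub>m (dim_row B)"
    using inv A unfolding invertible_mat_def inverts_mat_def by auto
  have "dim_col B = n" using B(1) by (metis index_mult_mat(3) index_one_mat(3))
  moreover have "dim_row B = n" using B(2) A by (metis carrier_matD(2) index_mult_mat(3) index_one_mat(3))
  ultimately have BC: "B \<in> carrier_mat n n" by auto
  then have "minv A = B" using B by (intro minv_inverse[OF A]) auto
  then show "minv A \<in> carrier_mat n n" "A * minv A = 1\<^sub>m n" "minv A * A = 1\<^sub>m n"
    using B BC by auto
qed

lemma minv_diag:
  assumes "\<And>j. j < n \<Longrightarrow> z - complex_of_real (x j) \<noteq> 0"
  shows "minv (z \<cdot>\<^sub>m 1\<^sub>m n - map_mat complex_of_real (mat_diag n x)) = mat_diag n (\<lambda>j. 1 / (z - complex_of_real (x j)))"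
proof -
  have eq: "z \<cdot>\<^sub>m 1\<^sub>m n - map_mat complex_of_real (mat_diag n x) = mat_diag n (\<lambda>j. z - complex_of_real (x j))"
    by (intro eq_matI) (auto simp: mat_diag_def)
  have one: "mat_diag n f = 1\<^sub>m n" if "\<And>j. j < n \<Longrightarrow> f j = (1::complex)" for f
    using that by (intro eq_matI) (auto simp: mat_diag_def)
  have "z \<noteq> complex_of_real (x j)" if "j < n" for j using assms[OF that] by simp
  then show ?thesis unfolding eq
    by (intro minv_inverse[of _ n]) (auto intro!: one)
qed

section \<open>The Pick matrix as Stein data and the entries of \<open>Theta\<close>\<close>

context
  fixes n l :: nat and x w \<gamma> \<xi> :: "nat \<Rightarrow> real"
  assumes inj: "inj_on x {..<n}" and inv: "invertible_mat (pick_matrix n l x w \<gamma> \<xi>)"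
begin

definition pick :: "real mat" where "pick = pick_matrix n l x w \<gamma> \<xi>"
definition c_entry :: "nat \<Rightarrow> real" where "c_entry j = (if j < l then w j else \<xi> j)"
definition e_entry :: "nat \<Rightarrow> real" where "e_entry j = (if j < l then 1 else 0)"
definition p_entry :: "nat \<Rightarrow> nat \<Rightarrow> real" where "p_entry i j = pick $$ (i, j)"
definition q_entry :: "nat \<Rightarrow> nat \<Rightarrow> real" where "q_entry i j = minv pick $$ (i, j)"

lemma pick_carrier: "pick \<in> carrier_mat n n"
  by (simp add: pick_def pick_matrix_def)

lemmas pick_inv = minv_invertible[OF pick_carrier inv[folded pick_def]]

lemma x_neq: "i < n \<Longrightarrow> j < n \<Longrightarrow> i \<noteq> j \<Longrightarrow> x i \<noteq> x j"
  using inj by (auto dest: inj_onD)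

lemma p_entry_sym: "i < n \<Longrightarrow> j < n \<Longrightarrow> p_entry i j = p_entry j i"
  using minus_divide_divide[of "w j - w i" "x j - x i"]
  by (simp add: p_entry_def pick_def pick_matrix_def)

lemma pick_transpose: "transpose_mat pick = pick"
  using pick_carrier p_entry_sym by (intro eq_matI) (auto simp: p_entry_def)

text \<open>The transpose of the inverse is an inverse of the transpose, which is the Pick matrix
  itself.\<close>

lemma q_entry_sym: "i < n \<Longrightarrow> j < n \<Longrightarrow> q_entry i j = q_entry j i"
proof -
  assume ij: "i < n" "j < n"
  have "minv pick = transpose_mat (minv pick)"
  proof (rule minv_inverse[OF pick_carrier])
    show "transpose_mat (minv pick) \<in> carrier_mat n n" using pick_inv(1) by simp
    show "pick * transpose_mat (minv pick) = 1\<^sub>m n"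
      using transpose_mult[OF pick_inv(1) pick_carrier] by (simp add: pick_transpose pick_inv(3) transpose_one)
    show "transpose_mat (minv pick) * pick = 1\<^sub>m n"
      using transpose_mult[OF pick_carrier pick_inv(1)] by (simp add: pick_transpose pick_inv(2) transpose_one)
  qed
  then have "minv pick $$ (i, j) = transpose_mat (minv pick) $$ (i, j)" by simp
  then show ?thesis using pick_inv(1) ij by (simp add: q_entry_def)
qed

text \<open>The displacement equation is checked block by block: the divided differences give
  \<open>w j - w i\<close>, the mixed blocks give \<open>\<xi>\<close> up to sign, and both sides
  vanish off the diagonal of the singular block as well as on the whole diagonal.\<close>

lemma stein_data_pick: "stein_data n x c_entry e_entry p_entry q_entry"
proof
  fix i j assume ij: "i < n" "j < n"
  show "p_entry i j = p_entry j i" "q_entry i j = q_entry j i" using p_entry_sym q_entry_sym ij by auto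
  have "(pick * minv pick) $$ (i, j) = (\<Sum>k<n. p_entry i k * q_entry k j)"
    unfolding mult_mat_entry[OF pick_carrier pick_inv(1) ij] p_entry_def q_entry_def ..
  then show "(\<Sum>k<n. p_entry i k * q_entry k j) = (if i = j then 1 else 0)"
    using ij by (simp add: pick_inv(2))
  show "p_entry i j * (x j - x i) = e_entry i * c_entry j - c_entry i * e_entry j"
  proof (cases "i = j")
    case False
    then have "x i \<noteq> x j" using x_neq ij by blast
    then have "x j - x i \<noteq> 0" and "\<xi> i / (x i - x j) * (x j - x i) = - \<xi> i" by (simp_all add: field_simps)
    then show ?thesis using ij False by (simp add: p_entry_def pick_def pick_matrix_def e_entry_def c_entry_def)
  qed simp
next
  show "inj_on x {..<n}" by (rule inj)
qed

interpretation S: stein_data n x c_entry e_entry p_entry q_entry by (rule stein_data_pick)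

lemma tilde_eq:
  assumes "i < n"
  shows "c_tilde n l x w \<gamma> \<xi> i = S.ct i" "e_tilde n l x w \<gamma> \<xi> i = S.et i"
    "p_tilde n l x w \<gamma> \<xi> i = q_entry i i"
proof -
  have rows: "C_row n l w \<xi> \<in> carrier_mat 1 n" "E_row n l \<in> carrier_mat 1 n"
    by (simp_all add: C_row_def E_row_def)
  have 0: "0 < (1::nat)" by simp
  show "c_tilde n l x w \<gamma> \<xi> i = S.ct i" "e_tilde n l x w \<gamma> \<xi> i = S.et i"
    unfolding c_tilde_def e_tilde_def pick_def[symmetric] S.ct_def S.et_def
      mult_mat_entry[OF rows(1) pick_inv(1) 0 assms] mult_mat_entry[OF rows(2) pick_inv(1) 0 assms]
    by (auto simp: C_row_def E_row_def c_entry_def e_entry_def q_entry_def intro!: sum.cong)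
  show "p_tilde n l x w \<gamma> \<xi> i = q_entry i i"
    by (simp add: p_tilde_def q_entry_def pick_def)
qed

definition ce_entry :: "nat \<Rightarrow> nat \<Rightarrow> real" where "ce_entry a j = (if a = 0 then c_entry j else e_entry j)"

text \<open>By symmetry of the inverse, its product with the transpose of \<open>CE\<close> has the
  columns \<open>ct\<close> and \<open>et\<close>. Right multiplication by \<open>J_mat\<close>
  swaps them, and the factors of the imaginary unit combine to the signs plus and minus.\<close>

lemma Theta_entry:
  assumes z: "z \<in> upper_half_plane" and a: "a < 2"
  shows "Theta n l x w \<gamma> \<xi> z $$ (a, 0) = (if a = 0 then 1 else 0) + (\<Sum>j<n. ce_entry a j * S.et j / (z - complex_of_real (x j)))"
    "Theta n l x w \<gamma> \<xi> z $$ (a, 1) = (if a = 1 then 1 else 0) - (\<Sum>j<n. ce_entry a j * S.ct j / (z - complex_of_real (x j)))"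
proof -
  have ne: "z - complex_of_real (x j) \<noteq> 0" for j
    using z by (auto simp: upper_half_plane_def complex_eq_iff)
  define CE where "CE = map_mat complex_of_real (C_row n l w \<xi> @\<^sub>r E_row n l)"
  define D where "D = mat_diag n (\<lambda>j. 1 / (z - complex_of_real (x j)))"
  define Q where "Q = map_mat complex_of_real (minv pick)"
  have rows: "C_row n l w \<xi> \<in> carrier_mat 1 n" "E_row n l \<in> carrier_mat 1 n"
    by (simp_all add: C_row_def E_row_def)
  have CEc: "CE \<in> carrier_mat 2 n"
    using carrier_append_rows[OF rows] by (simp add: CE_def numeral_2_eq_2)
  have CE: "CE $$ (a, j) = ce_entry a j" if "a < 2" "j < n" for a j
  proof -
    have "a = 0 \<or> a = 1" using that(1) by auto
    then show ?thesis
      using that(2) by (elim disjE) (simp_all add: CE_def append_rows_def C_row_def E_row_def ce_entry_def c_entry_def e_entry_def)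
  qed
  have Dc: "D \<in> carrier_mat n n" and Qc: "Q \<in> carrier_mat n n" using pick_inv(1) by (simp_all add: D_def Q_def)
  have Jc: "J_mat \<in> carrier_mat 2 2" unfolding carrier_mat_def by (simp add: J_mat_def mat_of_rows_list_def)
  have J: "J_mat $$ (0,0) = 0" "J_mat $$ (0,Suc 0) = - \<i>" "J_mat $$ (Suc 0,0) = \<i>" "J_mat $$ (Suc 0,Suc 0) = 0"
    by (simp_all add: J_mat_def mat_of_rows_list_def)
  define R where "R = Q * transpose_mat CE"
  have Rc: "R \<in> carrier_mat n 2" using Qc CEc by (simp add: R_def)
  have R: "R $$ (j, b) = (if b = 0 then S.ct j else S.et j)" if "j < n" "b < 2" for j b
  proof -
    have "R $$ (j, b) = (\<Sum>k<n. complex_of_real (q_entry j k) * ce_entry b k)"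
    proof -
      have "transpose_mat CE \<in> carrier_mat n 2" using CEc by simp
      from mult_mat_entry[OF Qc this that] show ?thesis
        unfolding R_def using that CEc pick_inv(1) by (auto simp: CE Q_def q_entry_def intro!: sum.cong)
    qed
    also have "\<dots> = complex_of_real (\<Sum>k<n. ce_entry b k * q_entry k j)"
      unfolding of_real_sum
    proof (intro sum.cong refl)
      fix k assume "k \<in> {..<n}"
      then show "complex_of_real (q_entry j k) * ce_entry b k = complex_of_real (ce_entry b k * q_entry k j)"
        using q_entry_sym[of j k] that by simp
    qed
    finally show ?thesis by (simp add: S.ct_def S.et_def ce_entry_def)
  qed
  define M where "M = CE * D * R"
  have Mc: "M \<in> carrier_mat 2 2" using CEc Dc Rc by (simp add: M_def)
  have CED: "(CE * D) $$ (a, j) = ce_entry a j / (z - complex_of_real (x j))" if "j < n" for j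
  proof -
    have "(CE * D) $$ (a, j) = (\<Sum>k<n. CE $$ (a, k) * (if k = j then 1 / (z - complex_of_real (x j)) else 0))"
      unfolding mult_mat_entry[OF CEc Dc a that]
      using that by (intro sum.cong refl) (simp add: D_def mat_diag_def)
    also have "\<dots> = (\<Sum>k<n. if k = j then CE $$ (a, k) * (1 / (z - complex_of_real (x j))) else 0)"
      by (intro sum.cong) auto
    finally show ?thesis using that CE[OF a that] by simp
  qed
  have M: "M $$ (a, b) = (\<Sum>j<n. ce_entry a j / (z - complex_of_real (x j)) * (if b = 0 then S.ct j else S.et j))" if "b < 2" for b
  proof -
    have "M $$ (a, b) = (\<Sum>j<n. (CE * D) $$ (a, j) * R $$ (j, b))"
      unfolding M_def by (rule mult_mat_entry[OF mult_carrier_mat[OF CEc Dc] Rc a that])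
    also have "\<dots> = (\<Sum>j<n. ce_entry a j / (z - complex_of_real (x j)) * (if b = 0 then S.ct j else S.et j))"
      using R that CED by (intro sum.cong) auto
    finally show ?thesis .
  qed
  have Th: "Theta n l x w \<gamma> \<xi> z = 1\<^sub>m 2 - \<i> \<cdot>\<^sub>m (M * J_mat)"
  proof -
    have "M = CE * D * Q * transpose_mat CE"
      unfolding M_def R_def using CEc Qc
      by (intro assoc_mult_mat[OF mult_carrier_mat[OF CEc Dc] Qc, symmetric]) simp
    then show ?thesis
      unfolding Theta_def Let_def CE_def[symmetric] pick_def[symmetric] Q_def[symmetric] minv_diag[OF ne] D_def[symmetric]
      by simp
  qed
  have MJ: "(M * J_mat) $$ (a, b) = M $$ (a, 0) * J_mat $$ (0, b) + M $$ (a, 1) * J_mat $$ (1, b)" if "b < 2" for b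
    unfolding mult_mat_entry[OF Mc Jc a that] by (simp add: numeral_2_eq_2)
  have ii: "\<i> * (s * \<i>) = - s" for s by (simp add: complex_eq_iff)
  show "Theta n l x w \<gamma> \<xi> z $$ (a, 0) = (if a = 0 then 1 else 0) + (\<Sum>j<n. ce_entry a j * S.et j / (z - complex_of_real (x j)))"
    using a Mc Jc MJ[of 0] M[of 1] J by (simp add: Th ii)
  show "Theta n l x w \<gamma> \<xi> z $$ (a, 1) = (if a = 1 then 1 else 0) - (\<Sum>j<n. ce_entry a j * S.ct j / (z - complex_of_real (x j)))"
    using a Mc Jc MJ[of 1] M[of 0] J by (simp add: Th ii)
qed

section \<open>Numerator and denominator of the transformed parameter, and the equivalence at a
  node\<close>

lemma LFT_eq:
  "LFT (Theta n l x w \<gamma> \<xi>) \<phi> = quotient_fun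
     (\<lambda>z. Theta n l x w \<gamma> \<xi> z $$ (0, 0) * fst (param_pair \<phi>) z + Theta n l x w \<gamma> \<xi> z $$ (0, 1) * snd (param_pair \<phi>))
     (\<lambda>z. Theta n l x w \<gamma> \<xi> z $$ (1, 0) * fst (param_pair \<phi>) z + Theta n l x w \<gamma> \<xi> z $$ (1, 1) * snd (param_pair \<phi>))"
  by (cases \<phi>) (simp_all add: LFT_def)

lemma sum_partial_fractions:
  fixes c s t d :: "nat \<Rightarrow> complex"
  shows "(\<Sum>j<n. c j * (s j * f - t j * k) / d j) = (\<Sum>j<n. c j * s j / d j) * f - (\<Sum>j<n. c j * t j / d j) * k"
proof -
  have "c j * (s j * f - t j * k) / d j = c j * s j / d j * f - c j * t j / d j * k" for j
    by (simp add: right_diff_distrib diff_divide_distrib mult.assoc)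
  then show ?thesis by (simp only: sum_distrib_right sum_subtractf)
qed

lemma numerator_eq:
  assumes "z \<in> upper_half_plane"
  shows "Theta n l x w \<gamma> \<xi> z $$ (0, 0) * f z + Theta n l x w \<gamma> \<xi> z $$ (0, 1) * complex_of_real k = S.U f k z"
proof -
  have "0 < (2::nat)" by simp
  note T = Theta_entry[OF assms this]
  show ?thesis
    unfolding T S.U_def S.u_def sum_partial_fractions by (simp add: ce_entry_def ring_distribs)
qed

lemma denominator_eq:
  assumes "z \<in> upper_half_plane"
  shows "Theta n l x w \<gamma> \<xi> z $$ (1, 0) * f z + Theta n l x w \<gamma> \<xi> z $$ (1, 1) * complex_of_real k = S.V f k z"
proof -
  have "1 < (2::nat)" by simp
  note T = Theta_entry[OF assms this]
  show ?thesis
    unfolding T S.V_def S.u_def sum_partial_fractions by (simp add: ce_entry_def ring_distribs)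
qed

text \<open>Both sides are equivalent to \<open>0 < K\<close> for
  \<open>K = p0 + q0 * q_entry i i\<close>: the right one by the asymptotics of the parameter, the
  left one by the limits of numerator and denominator.\<close>

lemma interpolation_iff:
  assumes \<xi>: "\<And>k. l \<le> k \<Longrightarrow> k < n \<Longrightarrow> \<xi> k \<noteq> 0" and \<phi>: "\<phi> \<in> ext_nevanlinna" and i: "i < n"
  shows "(if i < l then regular_condition (LFT (Theta n l x w \<gamma> \<xi>) \<phi>) (x i) (w i) (\<gamma> i)
          else singular_condition (LFT (Theta n l x w \<gamma> \<xi>) \<phi>) (x i) (\<xi> i)) \<longleftrightarrow>
    (if S.et i \<noteq> 0
     then cond_C1 \<phi> (x i) (S.ct i / S.et i) \<or> cond_C2 \<phi> (x i) (S.ct i / S.et i) \<or> cond_C3 \<phi> (x i) (S.ct i / S.et i) (q_entry i i) (S.et i)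
     else cond_C1_tilde \<phi> (x i) \<or> cond_C2_tilde \<phi> (x i) \<or> cond_C3_tilde \<phi> (x i) (q_entry i i) (S.ct i))"
proof -
  define f where "f = fst (param_pair \<phi>)"
  define k where "k = snd (param_pair \<phi>)"
  define N where "N = (\<lambda>z. Theta n l x w \<gamma> \<xi> z $$ (0, 0) * f z + Theta n l x w \<gamma> \<xi> z $$ (0, 1) * complex_of_real k)"
  define D where "D = (\<lambda>z. Theta n l x w \<gamma> \<xi> z $$ (1, 0) * f z + Theta n l x w \<gamma> \<xi> z $$ (1, 1) * complex_of_real k)"
  have f: "f \<in> nevanlinna" unfolding f_def by (rule param_pair_nevanlinna[OF \<phi>])
  have N: "N z = S.U f k z" and D: "D z = S.V f k z" if "z \<in> upper_half_plane" for z
    using numerator_eq[OF that, of f k] denominator_eq[OF that, of f k] by (simp_all add: N_def D_def)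
  have W: "LFT (Theta n l x w \<gamma> \<xi>) \<phi> = quotient_fun N D"
    unfolding LFT_eq N_def D_def f_def k_def ..
  have holo: "N holomorphic_on upper_half_plane" "D holomorphic_on upper_half_plane"
    using S.holomorphic_UV[OF f, of k] by (simp_all add: holomorphic_transform[OF _ N[symmetric]]
        holomorphic_transform[OF _ D[symmetric]])
  have "{z \<in> upper_half_plane. D z = 0} = {z \<in> upper_half_plane. S.V f k z = 0}" using D by auto
  then have fin: "(\<forall>z\<in>upper_half_plane. D z = 0) \<or> finite {z \<in> upper_half_plane. D z = 0}"
    using S.V_zeros[OF f, of k] D by simp
  have "c_entry i \<noteq> 0 \<or> e_entry i \<noteq> 0" using \<xi>[of i] i by (auto simp: c_entry_def e_entry_def)
  then have nz: "S.ct i \<noteq> 0 \<or> S.et i \<noteq> 0" by (rule S.tilde_nonzero[OF i])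
  obtain \<rho> p0 q0 where asy: "asymptotics f k (x i) (S.ct i) (S.et i) \<rho> p0 q0"
    and cond: "(if S.et i \<noteq> 0
     then cond_C1 \<phi> (x i) (S.ct i / S.et i) \<or> cond_C2 \<phi> (x i) (S.ct i / S.et i) \<or> cond_C3 \<phi> (x i) (S.ct i / S.et i) (q_entry i i) (S.et i)
     else cond_C1_tilde \<phi> (x i) \<or> cond_C2_tilde \<phi> (x i) \<or> cond_C3_tilde \<phi> (x i) (q_entry i i) (S.ct i))
     \<longleftrightarrow> 0 < p0 + q0 * q_entry i i"
    using param_asymptotics[OF \<phi> nz, of "x i" "q_entry i i"] unfolding f_def k_def by blast
  define K where "K = p0 + q0 * q_entry i i"
  have \<rho>: "eventually (\<lambda>z. \<rho> z \<noteq> 0) (nt (x i))" and q0: "q0 = 0 \<and> K = 1 \<or> q0 = 1"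
    using asy by (auto simp: asymptotics_def K_def)
  note lims = S.node_limits[OF i asy, folded K_def]
  have evN: "eventually (\<lambda>z. S.U f k z = N z) (nt (x i))" and evD: "eventually (\<lambda>z. S.V f k z = D z) (nt (x i))"
    using eventually_nt_upper by (eventually_elim, simp add: N D)+
  have L1: "((\<lambda>z. (z - x i) * N z / \<rho> z) \<longlongrightarrow> complex_of_real (c_entry i * K)) (nt (x i))"
    by (rule Lim_transform_eventually[OF lims(1)]) (use evN in eventually_elim, simp)
  have L2: "((\<lambda>z. (z - x i) * D z / \<rho> z) \<longlongrightarrow> complex_of_real (e_entry i * K)) (nt (x i))"
    by (rule Lim_transform_eventually[OF lims(2)]) (use evD in eventually_elim, simp)
  have L3: "((\<lambda>z. (e_entry i * N z - c_entry i * D z) / \<rho> z) \<longlongrightarrow> complex_of_real (p_entry i i * K - q0)) (nt (x i))"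
    by (rule Lim_transform_eventually[OF lims(3)]) (use evN evD in eventually_elim, simp)
  have "(if i < l then regular_condition (quotient_fun N D) (x i) (w i) (\<gamma> i)
          else singular_condition (quotient_fun N D) (x i) (\<xi> i)) \<longleftrightarrow> 0 < K"
  proof (cases "i < l")
    case True
    then have eqs: "c_entry i = w i" "e_entry i = 1" "p_entry i i = \<gamma> i"
      using i by (simp_all add: c_entry_def e_entry_def p_entry_def pick_def pick_matrix_def)
    have "regular_condition (quotient_fun N D) (x i) (w i) (\<gamma> i) \<longleftrightarrow> 0 < K"
      by (rule regular_condition_iff[OF holo fin \<rho> _ _ q0]) (use L2 L3 in \<open>simp_all add: eqs\<close>)
    then show ?thesis using True by simp
  next
    case False
    then have eqs: "c_entry i = \<xi> i" "e_entry i = 0" "p_entry i i = - \<xi> i"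
      using i by (simp_all add: c_entry_def e_entry_def p_entry_def pick_def pick_matrix_def)
    have \<xi>i: "\<xi> i \<noteq> 0" using \<xi>[of i] False i by simp
    \<comment> \<open>At a singular node \<open>e_entry i = 0\<close>, so the third limit concerns
      \<open>- \<xi> i * D / \<rho>\<close> with the value \<open>- \<xi> i * K - q0\<close>;
      division by \<open>- \<xi> i\<close> isolates the denominator.\<close>
    have "((\<lambda>z. - (1 / \<xi> i) * ((e_entry i * N z - c_entry i * D z) / \<rho> z)) \<longlongrightarrow>
        complex_of_real (- (1 / \<xi> i)) * complex_of_real (p_entry i i * K - q0)) (nt (x i))"
      by (intro tendsto_mult tendsto_const L3)
    moreover have "complex_of_real (- (1 / \<xi> i)) * complex_of_real (p_entry i i * K - q0) = complex_of_real (K + q0 / \<xi> i)"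
      unfolding of_real_mult[symmetric] eqs using \<xi>i by (simp add: field_simps)
    moreover have "- (1 / \<xi> i) * ((e_entry i * N z - c_entry i * D z) / \<rho> z) = D z / \<rho> z" for z
      unfolding eqs using \<xi>i by simp
    ultimately have "((\<lambda>z. D z / \<rho> z) \<longlongrightarrow> complex_of_real (K + q0 / \<xi> i)) (nt (x i))"
      by (simp only:)
    then have "singular_condition (quotient_fun N D) (x i) (\<xi> i) \<longleftrightarrow> 0 < K"
      using L1 unfolding eqs by (intro singular_condition_iff[OF fin \<rho> \<xi>i _ _ q0])
    then show ?thesis using False by simp
  qed
  then show ?thesis unfolding W cond K_def .
qed

end

theorem corollary2p8:
  fixes n l i :: nat
    and x w \<gamma> \<xi> :: "nat \<Rightarrow> real"
    and \<phi> :: ext_fun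
  assumes "inj_on x {..<n}"
    and "l \<le> n"
    and "\<And>k. l \<le> k \<Longrightarrow> k < n \<Longrightarrow> \<xi> k \<noteq> 0"
    and "invertible_mat (pick_matrix n l x w \<gamma> \<xi>)"
    and "\<phi> \<in> ext_nevanlinna"
    and "i < n"
  shows
    "(let W = LFT (Theta n l x w \<gamma> \<xi>) \<phi>;
          c = c_tilde n l x w \<gamma> \<xi> i;
          e = e_tilde n l x w \<gamma> \<xi> i;
          p = p_tilde n l x w \<gamma> \<xi> i;
          \<eta> = c / e
      in (if i < l then regular_condition W (x i) (w i) (\<gamma> i)
          else singular_condition W (x i) (\<xi> i))
         \<longleftrightarrow>
         (if e \<noteq> 0
          then cond_C1 \<phi> (x i) \<eta> \<or> cond_C2 \<phi> (x i) \<eta> \<or> cond_C3 \<phi> (x i) \<eta> p e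
          else cond_C1_tilde \<phi> (x i) \<or> cond_C2_tilde \<phi> (x i) \<or> cond_C3_tilde \<phi> (x i) p c))"
  unfolding Let_def tilde_eq[OF assms(1,4,6)]
  by (rule interpolation_iff[OF assms(1,4,3,5,6)])

end
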